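(* Fix $\alpha\in(0,1)$, let $r_\star\in(0,1)$ and $\mu\in[1/2,1]$ with $2\mu+\alpha\notin\mathbb{Z}$. Then the constant function $r_\star$ (an equilibrium of $r_t=G(r)$) is unstable in the topology of $h^{2\mu+\alpha}(\mathbb{T})$ for initial values in $h^{2\mu+\alpha}(\mathbb{T})$; that is, it is not true that for every $\varepsilon>0$ there exists $\delta>0$ such that for every $r_0\in h^{2\mu+\alpha}(\mathbb{T})$ with $\|r_0-r_\star\|_{h^{2\mu+\alpha}}<\delta$ the solution $r(\cdot,r_0)$ of $r_t=G(r)$, $r(0)=r_0$, exists globally in $C^1_{1-\mu}(\mathbb{R}_+,h^\alpha(\mathbb{T}))\cap C_{1-\mu}(\mathbb{R}_+,h^{2+\alpha}(\mathbb{T}))$ and satisfies $\|r(t,r_0)-r_\star\|_{h^{2\mu+\alpha}}<\varepsilon$ for all $t\ge0$.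
   Context: $\mathbb{T}=[-\pi,\pi]$ with endpoints identified; $h^{k+\alpha}(\mathbb{T})$ is the closure of $C^\infty(\mathbb{T})$ in $C^{k+\alpha}(\mathbb{T})$, and $h^\sigma$ for non-integer $\sigma>0$ accordingly. For a positive function $r$ on $\mathbb{T}$: $S(r)=\int_{\mathbb{T}}r\sqrt{1+r_x^2}dx$, $\mathcal{H}(r)=\frac{1}{r\sqrt{1+r_x^2}}-\frac{r_{xx}}{(1+r_x^2)^{3/2}}$, $h(r)=S(r)^{-1}\int_{\mathbb{T}}\mathcal{H}(r)r\sqrt{1+r_x^2}dx$, $G(r)=\sqrt{1+r_x^2}[h(r)-\mathcal{H}(r)]$. For $\mu\in(0,1)$, $C_{1-\mu}(\mathbb{R}_+,E)$ is the set of $u\in C((0,\infty),E)$ such that on each $(0,T]$, $t^{1-\mu}u(t)$ is bounded and uniformly continuous with $t^{1-\mu}\|u(t)\|_E\to0$ as $t\to0^+$; $C^1_{1-\mu}(\mathbb{R}_+,E)=\{u\in C^1((0,\infty),E):u,\dot u\in C_{1-\mu}\}$; for $\mu=1$ these are $C(\mathbb{R}_+,E)$, $C^1(\mathbb{R}_+,E)$. *)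

theory Defs
  imports "HOL-Analysis.Analysis"
begin

text \<open>Functions on the torus T = [-pi,pi] (endpoints identified) are represented
as 2pi-periodic functions on the real line.\<close>

definition periodic2pi :: "(real \<Rightarrow> real) \<Rightarrow> bool" where
  "periodic2pi f \<longleftrightarrow> (\<forall>x. f (x + 2*pi) = f x)"

definition Ck_per :: "nat \<Rightarrow> (real \<Rightarrow> real) \<Rightarrow> bool" where
  "Ck_per k f \<longleftrightarrow> periodic2pi f \<and>
     (\<forall>j<k. \<forall>x. (deriv ^^ j) f differentiable (at x)) \<and>
     continuous_on UNIV ((deriv ^^ k) f)"

definition smooth_per :: "(real \<Rightarrow> real) \<Rightarrow> bool" where
  "smooth_per f \<longleftrightarrow> periodic2pi f \<and> (\<forall>j. \<forall>x. (deriv ^^ j) f differentiable (at x))"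

definition sup_norm :: "(real \<Rightarrow> real) \<Rightarrow> real" where
  "sup_norm g = (SUP x. \<bar>g x\<bar>)"

definition holder_quot :: "real \<Rightarrow> (real \<Rightarrow> real) \<Rightarrow> real set" where
  "holder_quot \<beta> g = {\<bar>g x - g y\<bar> / \<bar>x - y\<bar> powr \<beta> | x y. x \<noteq> y}"

definition holder_seminorm :: "real \<Rightarrow> (real \<Rightarrow> real) \<Rightarrow> real" where
  "holder_seminorm \<beta> g = Sup (holder_quot \<beta> g)"

text \<open>The Hoelder space C^sigma(T), sigma > 0 non-integer, sigma = k + beta,
  k = floor sigma, 0 < beta < 1, with its standard norm.\<close>
definition C_holder :: "real \<Rightarrow> (real \<Rightarrow> real) \<Rightarrow> bool" where
  "C_holder \<sigma> f \<longleftrightarrow> Ck_per (nat \<lfloor>\<sigma>\<rfloor>) f \<and>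
     bdd_above (holder_quot (\<sigma> - of_int \<lfloor>\<sigma>\<rfloor>) ((deriv ^^ nat \<lfloor>\<sigma>\<rfloor>) f))"

definition hnorm :: "real \<Rightarrow> (real \<Rightarrow> real) \<Rightarrow> real" where
  "hnorm \<sigma> f = (\<Sum>j\<le>nat \<lfloor>\<sigma>\<rfloor>. sup_norm ((deriv ^^ j) f))
      + holder_seminorm (\<sigma> - of_int \<lfloor>\<sigma>\<rfloor>) ((deriv ^^ nat \<lfloor>\<sigma>\<rfloor>) f)"

definition little_holder :: "real \<Rightarrow> (real \<Rightarrow> real) \<Rightarrow> bool" where
  "little_holder \<sigma> f \<longleftrightarrow> C_holder \<sigma> f \<and>
     (\<forall>e>0. \<exists>g. smooth_per g \<and> hnorm \<sigma> (\<lambda>x. f x - g x) < e)"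

definition S_fun :: "(real \<Rightarrow> real) \<Rightarrow> real" where
  "S_fun r = integral {-pi..pi} (\<lambda>x. r x * sqrt (1 + (deriv r x)\<^sup>2))"

definition H_fun :: "(real \<Rightarrow> real) \<Rightarrow> real \<Rightarrow> real" where
  "H_fun r = (\<lambda>x. 1 / (r x * sqrt (1 + (deriv r x)\<^sup>2))
                 - deriv (deriv r) x / (1 + (deriv r x)\<^sup>2) powr (3/2))"

definition h_fun :: "(real \<Rightarrow> real) \<Rightarrow> real" where
  "h_fun r = integral {-pi..pi} (\<lambda>x. H_fun r x * r x * sqrt (1 + (deriv r x)\<^sup>2)) / S_fun r"

definition G_op :: "(real \<Rightarrow> real) \<Rightarrow> real \<Rightarrow> real" where
  "G_op r = (\<lambda>x. sqrt (1 + (deriv r x)\<^sup>2) * (h_fun r - H_fun r x))"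

definition tdom :: "real \<Rightarrow> real set" where
  "tdom \<mu> = (if \<mu> = 1 then {0..} else {0<..})"

definition wcont :: "real \<Rightarrow> real \<Rightarrow> (real \<Rightarrow> real \<Rightarrow> real) \<Rightarrow> bool" where
  "wcont \<mu> \<sigma> u \<longleftrightarrow>
     (\<forall>t\<in>tdom \<mu>. little_holder \<sigma> (u t)) \<and>
     (\<forall>t\<in>tdom \<mu>. \<forall>e>0. \<exists>d>0. \<forall>s\<in>tdom \<mu>. \<bar>s - t\<bar> < d \<longrightarrow>
         hnorm \<sigma> (\<lambda>x. u s x - u t x) < e) \<and>
     (\<mu> \<noteq> 1 \<longrightarrow>
       (\<forall>T>0. (\<exists>B. \<forall>t\<in>{0<..T}. t powr (1 - \<mu>) * hnorm \<sigma> (u t) \<le> B) \<and>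
              (\<forall>e>0. \<exists>d>0. \<forall>s\<in>{0<..T}. \<forall>t\<in>{0<..T}. \<bar>s - t\<bar> < d \<longrightarrow>
                  hnorm \<sigma> (\<lambda>x. s powr (1 - \<mu>) * u s x - t powr (1 - \<mu>) * u t x) < e)) \<and>
       ((\<lambda>t. t powr (1 - \<mu>) * hnorm \<sigma> (u t)) \<longlongrightarrow> 0) (at_right 0))"

definition has_hderiv :: "real \<Rightarrow> real set \<Rightarrow> (real \<Rightarrow> real \<Rightarrow> real) \<Rightarrow> real \<Rightarrow> (real \<Rightarrow> real) \<Rightarrow> bool" where
  "has_hderiv \<sigma> D u t v \<longleftrightarrow>
     ((\<lambda>s. hnorm \<sigma> (\<lambda>x. (u s x - u t x) / (s - t) - v x)) \<longlongrightarrow> 0) (at t within D)"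

definition wC1 :: "real \<Rightarrow> real \<Rightarrow> (real \<Rightarrow> real \<Rightarrow> real) \<Rightarrow> bool" where
  "wC1 \<mu> \<sigma> u \<longleftrightarrow> wcont \<mu> \<sigma> u \<and>
     (\<exists>u'. wcont \<mu> \<sigma> u' \<and> (\<forall>t\<in>tdom \<mu>. has_hderiv \<sigma> (tdom \<mu>) u t (u' t)))"

definition global_sol :: "real \<Rightarrow> real \<Rightarrow> (real \<Rightarrow> real) \<Rightarrow> (real \<Rightarrow> real \<Rightarrow> real) \<Rightarrow> bool" where
  "global_sol \<alpha> \<mu> r0 r \<longleftrightarrow>
     r 0 = r0 \<and>
     ((\<lambda>t. hnorm \<alpha> (\<lambda>x. r t x - r0 x)) \<longlongrightarrow> 0) (at_right 0) \<and>
     (\<forall>t\<ge>0. \<forall>x. r t x > 0) \<and>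
     wC1 \<mu> \<alpha> r \<and> wcont \<mu> (2 + \<alpha>) r \<and>
     (\<forall>t>0. has_hderiv \<alpha> {0<..} r t (G_op (r t)))"

definition stable_eq :: "real \<Rightarrow> real \<Rightarrow> real \<Rightarrow> bool" where
  "stable_eq \<alpha> \<mu> rs \<longleftrightarrow>
     (\<forall>\<epsilon>>0. \<exists>\<delta>>0. \<forall>r0. little_holder (2*\<mu> + \<alpha>) r0 \<and>
         hnorm (2*\<mu> + \<alpha>) (\<lambda>x. r0 x - rs) < \<delta> \<longrightarrow>
         (\<exists>r. global_sol \<alpha> \<mu> r0 r \<and>
              (\<forall>t\<ge>0. hnorm (2*\<mu> + \<alpha>) (\<lambda>x. r t x - rs) < \<epsilon>)))"

end

theory Submission
  imports Defs
begin

text \<open>Write \<open>v = r - r\<^sub>\<star>\<close> and let \<open>\<Phi>(v)\<close> be the squared \<open>L\<^sup>2\<close> norm of the first Fourier mode of \<open>v\<close> minus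
  that of the remaining modes. The linearization of \<open>G\<close> at \<open>r\<^sub>\<star>\<close> has the eigenvalue
  \<open>\<lambda> = 1/r\<^sub>\<star>\<^sup>2 - 1 > 0\<close> on the first mode and eigenvalues bounded away below \<open>\<lambda>\<close> on all others (on constants it vanishes).
  Since \<open>r\<^sub>x\<^sub>x / (1 + r\<^sub>x\<^sup>2) = (arctan r\<^sub>x)\<^sub>x\<close>, integration by parts bounds all nonlinear terms in \<open>d\<Phi>/dt\<close> by
  \<open>C \<epsilon> (\<parallel>v\<parallel>\<^sup>2 + \<parallel>v\<^sub>x\<parallel>\<^sup>2)\<close> in \<open>L\<^sup>2\<close>, as long as \<open>v\<close> is \<open>\<epsilon>\<close>-small in \<open>C\<^sup>1\<close>. Hence \<open>d\<Phi>/dt \<ge> 2 \<eta> \<Phi>\<close> with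
  \<open>\<eta> > 0\<close> for every solution that stays near \<open>r\<^sub>\<star>\<close>; starting from \<open>r\<^sub>\<star> + d cos x\<close>, where \<open>\<Phi> = \<pi> d\<^sup>2\<close>,
  the functional grows exponentially, which is impossible because it is bounded near \<open>r\<^sub>\<star>\<close>.\<close>

subsection \<open>Integrals over the torus and a Dirichlet--Wirtinger inequality\<close>

abbreviation torus_int :: "(real \<Rightarrow> real) \<Rightarrow> real" where
  "torus_int \<equiv> integral {-pi..pi}"

lemma torus_integrable:
  assumes "continuous_on UNIV f"
  shows "(f has_integral torus_int f) {-pi..pi}"
  by (intro integrable_integral integrable_continuous_real continuous_on_subset[OF assms]) auto

lemma torus_FTC:
  assumes "\<And>x. (F has_real_derivative f x) (at x)"
  shows "(f has_integral (F pi - F (-pi))) {-pi..pi}"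
  by (rule fundamental_theorem_of_calculus)
     (auto intro!: has_field_derivative_at_within assms simp: has_real_derivative_iff_has_vector_derivative[symmetric])

lemma torus_trig_integrals:
  "((\<lambda>x. 1) has_integral 2*pi) {-pi..pi}"
  "(cos has_integral 0) {-pi..pi}"
  "(sin has_integral 0) {-pi..pi}"
  "((\<lambda>x. (cos x)\<^sup>2) has_integral pi) {-pi..pi}"
  "((\<lambda>x. (sin x)\<^sup>2) has_integral pi) {-pi..pi}"
  "((\<lambda>x. cos x * sin x) has_integral 0) {-pi..pi}"
proof -
  show "((\<lambda>x. 1) has_integral 2*pi) {-pi..pi}"
    using torus_FTC[of "\<lambda>x. x" "\<lambda>x. 1"] by simp
  show "(cos has_integral 0) {-pi..pi}"
    using torus_FTC[of sin cos] by (auto intro!: derivative_eq_intros)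
  have "((\<lambda>x. - cos x) has_real_derivative sin x) (at x)" for x
    by (auto intro!: derivative_eq_intros)
  from torus_FTC[OF this] show "(sin has_integral 0) {-pi..pi}" by simp
  have "((\<lambda>x. (x + sin x * cos x)/2) has_real_derivative (cos x)\<^sup>2) (at x)" for x
    by (auto intro!: derivative_eq_intros simp: power2_eq_square[symmetric] sin_squared_eq)
  from torus_FTC[OF this] show "((\<lambda>x. (cos x)\<^sup>2) has_integral pi) {-pi..pi}" by simp
  have "((\<lambda>x. (x - sin x * cos x)/2) has_real_derivative (sin x)\<^sup>2) (at x)" for x
    by (auto intro!: derivative_eq_intros simp: power2_eq_square[symmetric] cos_squared_eq)
  from torus_FTC[OF this] show "((\<lambda>x. (sin x)\<^sup>2) has_integral pi) {-pi..pi}" by simp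
  have "((\<lambda>x. (sin x)\<^sup>2 / 2) has_real_derivative cos x * sin x) (at x)" for x
    by (auto intro!: derivative_eq_intros)
  from torus_FTC[OF this] show "((\<lambda>x. cos x * sin x) has_integral 0) {-pi..pi}" by simp
qed

lemma torus_by_parts:
  assumes f: "\<And>x. (f has_real_derivative f' x) (at x)" and g: "\<And>x. (g has_real_derivative g' x) (at x)"
    and c: "continuous_on UNIV f'"
    and per: "f (-pi) = f pi" "g (-pi) = g pi"
  shows "((\<lambda>x. f x * g' x) has_integral - torus_int (\<lambda>x. f' x * g x)) {-pi..pi}"
proof -
  have "((\<lambda>x. f x * g x) has_real_derivative (f' x * g x + f x * g' x)) (at x)" for x
    by (rule derivative_eq_intros f g | simp)+
  from torus_FTC[OF this] have 1: "((\<lambda>x. f' x * g x + f x * g' x) has_integral 0) {-pi..pi}"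
    using per by simp
  have "continuous_on UNIV g" using g by (meson DERIV_isCont continuous_at_imp_continuous_on)
  then have 2: "((\<lambda>x. f' x * g x) has_integral torus_int (\<lambda>x. f' x * g x)) {-pi..pi}"
    by (intro torus_integrable continuous_intros c)
  from has_integral_diff[OF 1 2] show ?thesis by simp
qed

text \<open>Completing the square with the solution \<open>k tan (k (x - m))\<close> of the Riccati equation
  \<open>y' = k\<^sup>2 + y\<^sup>2\<close>, which is regular on the whole interval because its length is less than \<open>\<pi> / k\<close>.\<close>

lemma dirichlet_wirtinger:
  fixes f f' :: "real \<Rightarrow> real"
  assumes f: "\<And>x. (f has_real_derivative f' x) (at x)" and c: "continuous_on UNIV f'"
    and ab: "a \<le> b" and k: "0 < k" "k * (b - a) < pi" and z: "f a = 0" "f b = 0"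
  shows "k\<^sup>2 * integral {a..b} (\<lambda>x. (f x)\<^sup>2) \<le> integral {a..b} (\<lambda>x. (f' x)\<^sup>2)"
proof -
  define m where "m = (a + b)/2"
  define T where "T x = k * tan (k * (x - m))" for x
  have cf: "continuous_on UNIV f" using f by (meson DERIV_isCont continuous_at_imp_continuous_on)
  have cos0: "cos (k * (x - m)) \<noteq> 0" if "x \<in> {a..b}" for x
  proof -
    have "\<bar>x - m\<bar> \<le> (b - a)/2" using that by (auto simp: m_def abs_if field_simps)
    then have "k * \<bar>x - m\<bar> \<le> k * ((b - a)/2)" using k by (intro mult_left_mono) auto
    moreover have "k * ((b - a)/2) < pi/2" "\<bar>k * (x - m)\<bar> = k * \<bar>x - m\<bar>"
      using k by (simp_all add: abs_mult)
    ultimately have "\<bar>k * (x - m)\<bar> < pi/2" by linarith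
    then have "0 < cos (k * (x - m))" by (intro cos_gt_zero_pi) linarith+
    then show ?thesis by simp
  qed
  have D: "((\<lambda>x. T x * (f x)\<^sup>2) has_real_derivative ((k\<^sup>2 + (T x)\<^sup>2) * (f x)\<^sup>2 + T x * (2 * f x * f' x))) (at x)"
    if "x \<in> {a..b}" for x
  proof -
    have e: "k * inverse ((cos (k * (x - m)))\<^sup>2) * k = k\<^sup>2 + (T x)\<^sup>2"
      unfolding power_inverse[symmetric] tan_sec[OF cos0[OF that], symmetric]
      by (simp add: T_def power2_eq_square algebra_simps)
    have "((\<lambda>x. T x) has_real_derivative k\<^sup>2 + (T x)\<^sup>2) (at x)"
      unfolding e[symmetric] unfolding T_def using cos0[OF that]
      by (auto intro!: derivative_eq_intros)
    then show ?thesis by (auto intro!: derivative_eq_intros f)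
  qed
  have "((\<lambda>x. (k\<^sup>2 + (T x)\<^sup>2) * (f x)\<^sup>2 + T x * (2 * f x * f' x)) has_integral
        (T b * (f b)\<^sup>2 - T a * (f a)\<^sup>2)) {a..b}"
  proof (rule fundamental_theorem_of_calculus[OF ab])
    fix x assume "x \<in> {a..b}"
    from D[OF this] show "((\<lambda>x. T x * (f x)\<^sup>2) has_vector_derivative
        (k\<^sup>2 + (T x)\<^sup>2) * (f x)\<^sup>2 + T x * (2 * f x * f' x)) (at x within {a..b})"
      unfolding has_real_derivative_iff_has_vector_derivative by (rule has_vector_derivative_at_within)
  qed
  then have 1: "((\<lambda>x. (k\<^sup>2 + (T x)\<^sup>2) * (f x)\<^sup>2 + T x * (2 * f x * f' x)) has_integral 0) {a..b}"
    using z by simp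
  have 2: "((\<lambda>x. (f x)\<^sup>2) has_integral integral {a..b} (\<lambda>x. (f x)\<^sup>2)) {a..b}"
    by (intro integrable_integral integrable_continuous_real continuous_intros continuous_on_subset[OF cf]) auto
  have 3: "((\<lambda>x. (f' x)\<^sup>2) has_integral integral {a..b} (\<lambda>x. (f' x)\<^sup>2)) {a..b}"
    by (intro integrable_integral integrable_continuous_real continuous_intros continuous_on_subset[OF c]) auto
  have "0 \<le> integral {a..b} (\<lambda>x. (f' x)\<^sup>2) + 0 - k\<^sup>2 * integral {a..b} (\<lambda>x. (f x)\<^sup>2)"
  proof (rule has_integral_nonneg[OF has_integral_diff[OF has_integral_add[OF 3 1] has_integral_mult_right[OF 2, of "k\<^sup>2"]]])
    fix x
    have "(f' x)\<^sup>2 + ((k\<^sup>2 + (T x)\<^sup>2) * (f x)\<^sup>2 + T x * (2 * f x * f' x)) - k\<^sup>2 * (f x)\<^sup>2 = (f' x + T x * f x)\<^sup>2"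
      by (simp add: power2_eq_square algebra_simps)
    then show "0 \<le> (f' x)\<^sup>2 + ((k\<^sup>2 + (T x)\<^sup>2) * (f x)\<^sup>2 + T x * (2 * f x * f' x)) - k\<^sup>2 * (f x)\<^sup>2" by simp
  qed
  then show ?thesis by simp
qed

lemma trig_interpolation:
  obtains A B C :: real where
    "A + B * cos (-pi) + C * sin (-pi) = y0"
    "A + B * cos (-pi/3) + C * sin (-pi/3) = y1"
    "A + B * cos (pi/3) + C * sin (pi/3) = y2"
proof -
  \<comment> \<open>The witnesses are the discrete Fourier coefficients of the data: over three
    equidistant nodes \<open>cos\<close> and \<open>sin\<close> sum to zero and are orthogonal, so
    the system is solved by averages against \<open>1\<close>, \<open>2 * cos\<close> and
    \<open>2 * sin\<close>.\<close>
  show ?thesis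
    by (intro that[of "(y0+y1+y2)/3" "(y1+y2-2*y0)/3" "(y2-y1)/sqrt 3"])
       (simp_all add: cos_60 sin_60, simp_all add: field_simps)
qed

text \<open>The zeros cut the torus into three pieces of length \<open>2*pi/3\<close>, and
  \<open>dirichlet_wirtinger\<close> applies on each with \<open>k = sqrt 2\<close>. The constant
  \<open>2\<close> exceeds \<open>1\<close>, the best constant for mean-free functions on the torus,
  and so separates the higher modes from the first.\<close>

lemma wirtinger_thirds:
  fixes f f' :: "real \<Rightarrow> real"
  assumes f: "\<And>x. (f has_real_derivative f' x) (at x)" and c: "continuous_on UNIV f'"
    and z: "f (-pi) = 0" "f (-pi/3) = 0" "f (pi/3) = 0" "f pi = 0"
  shows "2 * torus_int (\<lambda>x. (f x)\<^sup>2) \<le> torus_int (\<lambda>x. (f' x)\<^sup>2)"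
proof -
  have cf: "continuous_on UNIV f" using f by (meson DERIV_isCont continuous_at_imp_continuous_on)
  have split: "torus_int (\<lambda>x. (g x)\<^sup>2) = integral {-pi.. -pi/3} (\<lambda>x. (g x)\<^sup>2) + integral {-pi/3..pi/3} (\<lambda>x. (g x)\<^sup>2)
     + integral {pi/3..pi} (\<lambda>x. (g x)\<^sup>2)" if "continuous_on UNIV g" for g :: "real \<Rightarrow> real"
  proof -
    have i: "(\<lambda>x. (g x)\<^sup>2) integrable_on {a..b}" for a b
      by (intro integrable_continuous_real continuous_intros continuous_on_subset[OF that]) auto
    have p: "-pi/3 \<le> pi" "-pi \<le> -pi/3" "-pi/3 \<le> pi/3" "pi/3 \<le> pi"
      using pi_gt_zero by linarith+
    have "integral {-pi.. -pi/3} (\<lambda>x. (g x)\<^sup>2) + integral {-pi/3..pi} (\<lambda>x. (g x)\<^sup>2) = torus_int (\<lambda>x. (g x)\<^sup>2)"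
      by (intro Henstock_Kurzweil_Integration.integral_combine i p)
    moreover have "integral {-pi/3..pi/3} (\<lambda>x. (g x)\<^sup>2) + integral {pi/3..pi} (\<lambda>x. (g x)\<^sup>2) = integral {-pi/3..pi} (\<lambda>x. (g x)\<^sup>2)"
      by (intro Henstock_Kurzweil_Integration.integral_combine i p)
    ultimately show ?thesis by simp
  qed
  \<comment> \<open>Squared, this is \<open>8 < 9\<close>; it is the length condition
    \<open>sqrt 2 * (2*pi/3) < pi\<close>.\<close>
  have s: "sqrt 2 * 2 < 3" by (rule power2_less_imp_less) (simp_all add: power_mult_distrib)
  then have "pi * (sqrt 2 * 2) < pi * 3" by (intro mult_strict_left_mono) auto
  then have "sqrt 2 * (pi * (2/3)) < pi" by (simp add: field_simps)
  then have W: "2 * integral {a..b} (\<lambda>x. (f x)\<^sup>2) \<le> integral {a..b} (\<lambda>x. (f' x)\<^sup>2)"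
    if "b - a = pi * (2/3)" "f a = 0" "f b = 0" for a b
    using dirichlet_wirtinger[OF f c, of a b "sqrt 2"] that pi_gt_zero by force
  show ?thesis unfolding split[OF cf] split[OF c] distrib_left
    by (intro add_mono W z) simp_all
qed

subsection \<open>The first Fourier mode\<close>

text \<open>\<open>growth_form\<close> is the squared \<open>L\<^sup>2\<close> norm of the first Fourier mode of \<open>v\<close> minus that of all other modes;
  \<open>q\<close> is \<open>v\<close> reflected accordingly, so that \<open>growth_form = \<integral> v q\<close> and \<open>q\<close> has the same norms as \<open>v\<close>.\<close>

locale c2_torus_function =
  fixes v v1 v2 :: "real \<Rightarrow> real"
  assumes dv: "\<And>x. (v has_real_derivative v1 x) (at x)"
    and dv1: "\<And>x. (v1 has_real_derivative v2 x) (at x)"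
    and cont_v2: "continuous_on UNIV v2"
    and per: "v (-pi) = v pi" "v1 (-pi) = v1 pi"
begin

lemma cont_v: "continuous_on UNIV v"
  using dv by (meson DERIV_isCont continuous_at_imp_continuous_on)

lemma cont_v1: "continuous_on UNIV v1"
  using dv1 by (meson DERIV_isCont continuous_at_imp_continuous_on)

definition "mass = torus_int v"
definition "cos_mode = torus_int (\<lambda>x. v x * cos x) / pi"
definition "sin_mode = torus_int (\<lambda>x. v x * sin x) / pi"
definition "l2 = torus_int (\<lambda>x. (v x)\<^sup>2)"
definition "dirichlet = torus_int (\<lambda>x. (v1 x)\<^sup>2)"
text \<open>The squared L2 norm of \<open>cos_mode * cos x + sin_mode * sin x\<close>, and equally
  of its derivative, since differentiation only rotates the two coefficients. It can therefore be
  split off from \<open>l2\<close> and from \<open>dirichlet\<close> alike.\<close>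

definition "first_mode = pi * (cos_mode\<^sup>2 + sin_mode\<^sup>2)"
definition "growth_form = 2 * first_mode - l2"
definition "q x = 2 * (cos_mode * cos x + sin_mode * sin x) - v x"
definition "q1 x = 2 * (sin_mode * cos x - cos_mode * sin x) - v1 x"

lemma basic_integrals:
  "(v has_integral mass) {-pi..pi}"
  "((\<lambda>x. v x * cos x) has_integral pi * cos_mode) {-pi..pi}"
  "((\<lambda>x. v x * sin x) has_integral pi * sin_mode) {-pi..pi}"
  "((\<lambda>x. (v x)\<^sup>2) has_integral l2) {-pi..pi}"
  "((\<lambda>x. (v1 x)\<^sup>2) has_integral dirichlet) {-pi..pi}"
  "((\<lambda>x. v1 x * cos x) has_integral pi * sin_mode) {-pi..pi}"
  "((\<lambda>x. v1 x * sin x) has_integral - (pi * cos_mode)) {-pi..pi}"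
proof -
  note c = continuous_intros cont_v cont_v1
  show "(v has_integral mass) {-pi..pi}" unfolding mass_def by (intro torus_integrable c)
  have i: "((\<lambda>x. v x * cos x) has_integral torus_int (\<lambda>x. v x * cos x)) {-pi..pi}"
    "((\<lambda>x. v x * sin x) has_integral torus_int (\<lambda>x. v x * sin x)) {-pi..pi}"
    by (intro torus_integrable c)+
  then show "((\<lambda>x. v x * cos x) has_integral pi * cos_mode) {-pi..pi}"
    "((\<lambda>x. v x * sin x) has_integral pi * sin_mode) {-pi..pi}"
    by (simp_all add: cos_mode_def sin_mode_def)
  show "((\<lambda>x. (v x)\<^sup>2) has_integral l2) {-pi..pi}" unfolding l2_def by (intro torus_integrable c)
  show "((\<lambda>x. (v1 x)\<^sup>2) has_integral dirichlet) {-pi..pi}"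
    unfolding dirichlet_def by (intro torus_integrable c)
  have "((\<lambda>x. cos x * v1 x) has_integral - torus_int (\<lambda>x. - sin x * v x)) {-pi..pi}"
    by (rule torus_by_parts) (auto intro!: derivative_eq_intros dv c simp: per)
  then show "((\<lambda>x. v1 x * cos x) has_integral pi * sin_mode) {-pi..pi}"
    by (simp add: sin_mode_def mult.commute)
  have "((\<lambda>x. sin x * v1 x) has_integral - torus_int (\<lambda>x. cos x * v x)) {-pi..pi}"
    by (rule torus_by_parts) (auto intro!: derivative_eq_intros dv c simp: per)
  then show "((\<lambda>x. v1 x * sin x) has_integral - (pi * cos_mode)) {-pi..pi}"
    by (simp add: cos_mode_def mult.commute)
qed

lemmas integral_rules = has_integral_add has_integral_diff has_integral_mult_right
  basic_integrals torus_trig_integrals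

text \<open>Pythagoras: the distance to a trigonometric polynomial splits into the distance to the
  orthogonal projection and the squared errors of the coefficients, where the mean is
  \<open>mass/(2*pi)\<close>.\<close>

lemma l2_distance:
  "((\<lambda>x. (v x - (A + B * cos x + C * sin x))\<^sup>2) has_integral l2 - first_mode - mass\<^sup>2 / (2*pi)
    + 2 * (pi * (A - mass/(2*pi))\<^sup>2) + pi * ((B - cos_mode)\<^sup>2 + (C - sin_mode)\<^sup>2)) {-pi..pi}"
proof -
  have "((\<lambda>x. (v x)\<^sup>2 - 2 * (A * v x + B * (v x * cos x) + C * (v x * sin x))
      + (A\<^sup>2 * 1 + B\<^sup>2 * (cos x)\<^sup>2 + C\<^sup>2 * (sin x)\<^sup>2 + 2 * (A * B) * cos x + 2 * (A * C) * sin x + 2 * (B * C) * (cos x * sin x)))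
    has_integral (l2 - 2 * (A * mass + B * (pi * cos_mode) + C * (pi * sin_mode))
      + (A\<^sup>2 * (2*pi) + B\<^sup>2 * pi + C\<^sup>2 * pi + 2 * (A * B) * 0 + 2 * (A * C) * 0 + 2 * (B * C) * 0))) {-pi..pi}"
    by (intro integral_rules)
  moreover have "l2 - 2 * (A * mass + B * (pi * cos_mode) + C * (pi * sin_mode))
      + (A\<^sup>2 * (2*pi) + B\<^sup>2 * pi + C\<^sup>2 * pi + 2 * (A * B) * 0 + 2 * (A * C) * 0 + 2 * (B * C) * 0)
    = l2 - first_mode - mass\<^sup>2 / (2*pi) + 2 * (pi * (A - mass/(2*pi))\<^sup>2) + pi * ((B - cos_mode)\<^sup>2 + (C - sin_mode)\<^sup>2)"
    by (simp add: first_mode_def power2_eq_square field_simps)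
  moreover have "(\<lambda>x. (v x - (A + B * cos x + C * sin x))\<^sup>2) = (\<lambda>x. (v x)\<^sup>2 - 2 * (A * v x + B * (v x * cos x) + C * (v x * sin x))
      + (A\<^sup>2 * 1 + B\<^sup>2 * (cos x)\<^sup>2 + C\<^sup>2 * (sin x)\<^sup>2 + 2 * (A * B) * cos x + 2 * (A * C) * sin x + 2 * (B * C) * (cos x * sin x)))"
    by (auto simp: power2_eq_square algebra_simps)
  ultimately show ?thesis by (simp only:)
qed

text \<open>The comparison function is the derivative of the polynomial in
  \<open>l2_distance\<close>. The coefficient error is the same as there apart from the constant,
  which differentiation kills; this lets \<open>higher_modes_wirtinger\<close> discard the
  errors.\<close>

lemma dirichlet_distance:
  "((\<lambda>x. (v1 x - (C * cos x - B * sin x))\<^sup>2) has_integral dirichlet - first_mode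
    + pi * ((B - cos_mode)\<^sup>2 + (C - sin_mode)\<^sup>2)) {-pi..pi}"
proof -
  have "((\<lambda>x. (v1 x)\<^sup>2 - 2 * (C * (v1 x * cos x) - B * (v1 x * sin x))
      + (C\<^sup>2 * (cos x)\<^sup>2 + B\<^sup>2 * (sin x)\<^sup>2 - 2 * (B * C) * (cos x * sin x)))
    has_integral (dirichlet - 2 * (C * (pi * sin_mode) - B * (- (pi * cos_mode)))
      + (C\<^sup>2 * pi + B\<^sup>2 * pi - 2 * (B * C) * 0))) {-pi..pi}"
    by (intro integral_rules)
  moreover have "dirichlet - 2 * (C * (pi * sin_mode) - B * (- (pi * cos_mode))) + (C\<^sup>2 * pi + B\<^sup>2 * pi - 2 * (B * C) * 0)
    = dirichlet - first_mode + pi * ((B - cos_mode)\<^sup>2 + (C - sin_mode)\<^sup>2)"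
    by (simp add: first_mode_def power2_eq_square field_simps)
  moreover have "(\<lambda>x. (v1 x - (C * cos x - B * sin x))\<^sup>2) = (\<lambda>x. (v1 x)\<^sup>2 - 2 * (C * (v1 x * cos x) - B * (v1 x * sin x))
      + (C\<^sup>2 * (cos x)\<^sup>2 + B\<^sup>2 * (sin x)\<^sup>2 - 2 * (B * C) * (cos x * sin x)))"
    by (auto simp: power2_eq_square algebra_simps)
  ultimately show ?thesis by (simp only:)
qed

lemma bessel_first_modes: "0 \<le> l2 - first_mode - mass\<^sup>2 / (2*pi)"
  using has_integral_nonneg[OF l2_distance[of "mass/(2*pi)" cos_mode sin_mode]] by simp

text \<open>Subtracting the trigonometric interpolant of \<open>v\<close> at three equidistant nodes produces zeros at distance
  \<open>2\<pi>/3 < \<pi>/\<surd>2\<close>; orthogonality turns the resulting inequality into one for the modes beyond the first.\<close>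

lemma higher_modes_wirtinger:
  "2 * (l2 - first_mode - mass\<^sup>2 / (2*pi)) \<le> dirichlet - first_mode"
proof -
  obtain A B C where ABC: "A + B * cos (-pi) + C * sin (-pi) = v (-pi)"
    "A + B * cos (-pi/3) + C * sin (-pi/3) = v (-pi/3)"
    "A + B * cos (pi/3) + C * sin (pi/3) = v (pi/3)"
    by (rule trig_interpolation)
  define f where "f x = v x - (A + B * cos x + C * sin x)" for x
  define f' where "f' x = v1 x - (C * cos x - B * sin x)" for x
  have "2 * torus_int (\<lambda>x. (f x)\<^sup>2) \<le> torus_int (\<lambda>x. (f' x)\<^sup>2)"
  proof (rule wirtinger_thirds)
    show "(f has_real_derivative f' x) (at x)" for x
      unfolding f_def f'_def by (auto intro!: derivative_eq_intros dv)
    show "continuous_on UNIV f'" unfolding f'_def by (intro continuous_intros cont_v1)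
    show "f (-pi) = 0" "f (-pi/3) = 0" "f (pi/3) = 0" using ABC by (simp_all add: f_def)
    show "f pi = 0" using ABC(1) per by (simp add: f_def)
  qed
  then have "2 * (l2 - first_mode - mass\<^sup>2 / (2*pi) + 2 * (pi * (A - mass/(2*pi))\<^sup>2)
       + pi * ((B - cos_mode)\<^sup>2 + (C - sin_mode)\<^sup>2))
     \<le> dirichlet - first_mode + pi * ((B - cos_mode)\<^sup>2 + (C - sin_mode)\<^sup>2)"
    unfolding f_def f'_def integral_unique[OF l2_distance] integral_unique[OF dirichlet_distance] .
  moreover have "0 \<le> pi * (A - mass/(2*pi))\<^sup>2" "0 \<le> pi * ((B - cos_mode)\<^sup>2 + (C - sin_mode)\<^sup>2)" by simp_all
  moreover have "2 * x \<le> y" if "2 * (x + 2 * P + D) \<le> y + D" "0 \<le> P" "0 \<le> D" for x y P D :: real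
    using that by simp
  ultimately show ?thesis by blast
qed

lemma dq: "(q has_real_derivative q1 x) (at x)"
  unfolding q_def q1_def by (auto intro!: derivative_eq_intros dv)

lemma q_cont: "continuous_on UNIV q" "continuous_on UNIV q1"
  unfolding q_def q1_def by (intro continuous_intros cont_v cont_v1)+

text \<open>With \<open>P\<close> the orthogonal projection onto the first mode,
  \<open>q = (2*P - 1) v\<close>. This reflection is an isometry that commutes with differentiation,
  reverses the mean, and in each pairing keeps the first-mode contribution while flipping the sign
  of the rest.\<close>

lemma q_integrals:
  "(q has_integral - mass) {-pi..pi}"
  "((\<lambda>x. q x * v x) has_integral growth_form) {-pi..pi}"
  "((\<lambda>x. (q x)\<^sup>2) has_integral l2) {-pi..pi}"
  "((\<lambda>x. q1 x * v1 x) has_integral 2 * first_mode - dirichlet) {-pi..pi}"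
  "((\<lambda>x. (q1 x)\<^sup>2) has_integral dirichlet) {-pi..pi}"
proof -
  define a b where "a = cos_mode" and "b = sin_mode"
  note ab = a_def[symmetric] b_def[symmetric]
  note rules = integral_rules[unfolded ab]
  have "((\<lambda>x. 2 * (a * cos x + b * sin x) - v x) has_integral 2 * (a * 0 + b * 0) - mass) {-pi..pi}"
    by (intro rules)
  then show "(q has_integral - mass) {-pi..pi}" by (simp add: q_def[abs_def] ab)
  have "((\<lambda>x. 2 * (a * (v x * cos x) + b * (v x * sin x)) - (v x)\<^sup>2) has_integral 
     2 * (a * (pi * a) + b * (pi * b)) - l2) {-pi..pi}"
    by (intro rules)
  then show "((\<lambda>x. q x * v x) has_integral growth_form) {-pi..pi}"
    by (simp add: q_def ab growth_form_def first_mode_def power2_eq_square algebra_simps)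
  have "((\<lambda>x. 4 * (a\<^sup>2 * (cos x)\<^sup>2 + b\<^sup>2 * (sin x)\<^sup>2 + 2 * (a * b) * (cos x * sin x)
       - (a * (v x * cos x) + b * (v x * sin x))) + (v x)\<^sup>2) has_integral 
     4 * (a\<^sup>2 * pi + b\<^sup>2 * pi + 2 * (a * b) * 0 - (a * (pi * a) + b * (pi * b))) + l2) {-pi..pi}"
    by (intro rules)
  then show "((\<lambda>x. (q x)\<^sup>2) has_integral l2) {-pi..pi}"
    by (simp add: q_def ab power2_eq_square algebra_simps)
  have "((\<lambda>x. 2 * (b * (v1 x * cos x) - a * (v1 x * sin x)) - (v1 x)\<^sup>2) has_integral 
     2 * (b * (pi * b) - a * (- (pi * a))) - dirichlet) {-pi..pi}"
    by (intro rules)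
  then show "((\<lambda>x. q1 x * v1 x) has_integral 2 * first_mode - dirichlet) {-pi..pi}"
    by (simp add: q1_def ab growth_form_def first_mode_def power2_eq_square algebra_simps)
  have "((\<lambda>x. 4 * (b\<^sup>2 * (cos x)\<^sup>2 + a\<^sup>2 * (sin x)\<^sup>2 - 2 * (a * b) * (cos x * sin x)
       - (b * (v1 x * cos x) - a * (v1 x * sin x))) + (v1 x)\<^sup>2) has_integral 
     4 * (b\<^sup>2 * pi + a\<^sup>2 * pi - 2 * (a * b) * 0 - (b * (pi * b) - a * (- (pi * a)))) + dirichlet) {-pi..pi}"
    by (intro rules)
  then show "((\<lambda>x. (q1 x)\<^sup>2) has_integral dirichlet) {-pi..pi}"
    by (simp add: q1_def ab power2_eq_square algebra_simps)
qed

lemma nonneg: "0 \<le> l2" "0 \<le> dirichlet" "0 \<le> first_mode"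
  using has_integral_nonneg[OF basic_integrals(4)] has_integral_nonneg[OF basic_integrals(5)]
  by (auto simp: first_mode_def)

end

subsection \<open>The flow operator near a cylinder\<close>

text \<open>By the mean value theorem \<open>arctan z = z / (1 + t\<^sup>2)\<close> for some
  \<open>t\<close> between \<open>0\<close> and \<open>z\<close>, and oddness covers negative
  arguments. The error against the linear term is cubic, which leaves a small factor to
  spare.\<close>

lemma arctan_minus_id_bound:
  fixes y :: real
  shows "\<bar>arctan y - y\<bar> \<le> y\<^sup>2 * \<bar>y\<bar>" "0 \<le> y * arctan y" "y * arctan y \<le> y\<^sup>2"
proof -
  have *: "0 \<le> arctan z \<and> arctan z \<le> z \<and> z - arctan z \<le> z\<^sup>2 * z" if "0 \<le> z" for z :: real
  proof -
    have "\<exists>t>0. t < z \<and> arctan z - arctan 0 = (z - 0) * inverse (1 + t\<^sup>2)" if "0 < z"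
      using that by (intro MVT2) (auto intro!: derivative_eq_intros simp: divide_inverse)
    then obtain t where t: "0 \<le> t" "t \<le> z" "arctan z = z * inverse (1 + t\<^sup>2)"
      using \<open>0 \<le> z\<close> by (cases "z = 0") force+
    have p: "0 < 1 + t\<^sup>2" by (simp add: add_pos_nonneg)
    then have "z - arctan z = z * (t\<^sup>2 / (1 + t\<^sup>2))" using t by (simp add: field_simps)
    moreover have "t\<^sup>2 / (1 + t\<^sup>2) \<le> t\<^sup>2" using p by (simp add: field_simps)
    moreover have "t\<^sup>2 \<le> z\<^sup>2" using t by (simp add: power_mono)
    ultimately have "z - arctan z \<le> z * z\<^sup>2" using \<open>0 \<le> z\<close> by (metis order_trans mult_left_mono)
    moreover have "0 \<le> z - arctan z" unfolding \<open>z - arctan z = _\<close> using p \<open>0 \<le> z\<close> by simp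
    ultimately show ?thesis using \<open>0 \<le> z\<close> by (simp add: mult.commute)
  qed
  have "\<bar>arctan y - y\<bar> \<le> y\<^sup>2 * \<bar>y\<bar> \<and> 0 \<le> y * arctan y \<and> y * arctan y \<le> y\<^sup>2"
  proof (cases "0 \<le> y")
    case True
    then show ?thesis using *[of y] mult_left_mono[of "arctan y" y y] by (auto simp: power2_eq_square)
  next
    case False
    then show ?thesis using *[of "-y"] mult_left_mono[of "arctan (-y)" "-y" "-y"]
      by (auto simp: power2_eq_square arctan_minus mult_nonpos_nonpos)
  qed
  then show "\<bar>arctan y - y\<bar> \<le> y\<^sup>2 * \<bar>y\<bar>" "0 \<le> y * arctan y" "y * arctan y \<le> y\<^sup>2" by blast+
qed

lemma sqrt_one_plus_square_bounds:
  fixes y :: real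
  shows "0 \<le> sqrt (1 + y\<^sup>2) - 1" "sqrt (1 + y\<^sup>2) - 1 \<le> y\<^sup>2 / 2"
proof -
  show "0 \<le> sqrt (1 + y\<^sup>2) - 1" by simp
  have "sqrt (1 + y\<^sup>2) \<le> 1 + y\<^sup>2 / 2"
    by (rule real_le_lsqrt) (auto simp: power2_sum)
  then show "sqrt (1 + y\<^sup>2) - 1 \<le> y\<^sup>2 / 2" by simp
qed

text \<open>A weighted Young inequality: a nonlinear term whose second factor is at most
  \<open>e\<close> times a linear quantity costs, once integrated, only \<open>e\<close> times
  squared L2 norms.\<close>

lemma abs_mult_le_half_squares:
  fixes a b c e :: real
  assumes "\<bar>c\<bar> \<le> e * \<bar>b\<bar>" "0 \<le> e"
  shows "\<bar>a * c\<bar> \<le> e * ((a\<^sup>2 + b\<^sup>2)/2)"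
proof -
  have "\<bar>a * c\<bar> \<le> \<bar>a\<bar> * (e * \<bar>b\<bar>)" using assms by (simp add: abs_mult mult_left_mono)
  also have "\<dots> = e * (\<bar>a\<bar> * \<bar>b\<bar>)" by simp
  also have "\<bar>a\<bar> * \<bar>b\<bar> \<le> (a\<^sup>2 + b\<^sup>2)/2"
    using sum_squares_bound[of "\<bar>a\<bar>" "\<bar>b\<bar>"] by simp
  finally show ?thesis using assms by (simp add: mult_left_mono)
qed

text \<open>Smallness is required only of \<open>v\<close> and \<open>v1\<close>: for
  \<open>\<mu> = 1/2\<close> the stability norm of order \<open>1 + \<alpha>\<close> sees no second
  derivative. The integral estimates below therefore remove \<open>v2\<close> by integration by
  parts. The bound \<open>e \<le> rs/2\<close> keeps the radius away from zero.\<close>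

locale near_cylinder = c2_torus_function +
  fixes rs e :: real
  assumes rs: "0 < rs" and e: "0 < e" "e \<le> 1" "e \<le> rs/2"
    and small: "\<And>x. \<bar>v x\<bar> \<le> e" "\<And>x. \<bar>v1 x\<bar> \<le> e"
begin

abbreviation "r \<equiv> \<lambda>x. rs + v x"
abbreviation "w \<equiv> \<lambda>x. sqrt (1 + (v1 x)\<^sup>2)"
abbreviation "S \<equiv> S_fun r"
abbreviation "h \<equiv> h_fun r"

lemma deriv_r: "deriv r = v1" "deriv v1 = v2"
proof -
  have "(r has_real_derivative v1 x) (at x)" for x
    by (auto intro!: derivative_eq_intros dv)
  then show "deriv r = v1" "deriv v1 = v2" using dv1 by (auto intro!: ext DERIV_imp_deriv)
qed

lemma r_bounds: "rs/2 \<le> r x" "r x \<le> rs + e" "r x \<le> 3/2 * rs" "0 < r x"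
  using small(1)[of x] e rs by (auto simp: abs_le_iff)

lemma w_bounds: "1 \<le> w x" "w x - 1 \<le> (v1 x)\<^sup>2/2" "w x \<le> 1 + e" "w x - 1 \<le> e * \<bar>v1 x\<bar>"
proof -
  show "1 \<le> w x" by simp
  show 1: "w x - 1 \<le> (v1 x)\<^sup>2/2" by (rule sqrt_one_plus_square_bounds)
  have 2: "(v1 x)\<^sup>2 \<le> e * \<bar>v1 x\<bar>" 
    using mult_right_mono[OF small(2)[of x], of "\<bar>v1 x\<bar>"] by (simp add: power2_eq_square)
  have "e * \<bar>v1 x\<bar> \<le> e * 1" using small(2)[of x] e by (intro mult_left_mono) auto
  then show "w x \<le> 1 + e" "w x - 1 \<le> e * \<bar>v1 x\<bar>" using 1 2 zero_le_power2[of "v1 x"] by linarith+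
qed

lemma S_integral: "((\<lambda>x. r x * w x) has_integral S) {-pi..pi}"
  unfolding S_fun_def deriv_r by (intro torus_integrable continuous_intros cont_v cont_v1)

lemma S_bounds: "pi * rs \<le> S" "S \<le> 2 * pi * ((rs + e) * (1 + e))" "0 < S"
proof -
  have "rs/2 * 1 \<le> r x * w x" "r x * w x \<le> (rs + e) * (1 + e)" for x
    using r_bounds[of x] w_bounds[of x] rs e by (intro mult_mono; linarith)+
  then have b: "rs/2 * 1 \<le> r x * w x" "r x * w x \<le> ((rs + e) * (1 + e)) * 1" for x by simp_all
  from has_integral_le[OF has_integral_mult_right[OF torus_trig_integrals(1)] S_integral b(1)]
    show 1: "pi * rs \<le> S" by (simp add: mult.commute)
  from has_integral_le[OF S_integral has_integral_mult_right[OF torus_trig_integrals(1)] b(2)]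
    show "S \<le> 2 * pi * ((rs + e) * (1 + e))" by (simp add: mult_ac)
  show "0 < S" using 1 rs mult_pos_pos[OF pi_gt_zero rs] by linarith
qed

lemma H_fun_eq: "H_fun r x = 1 / (r x * w x) - v2 x / ((1 + (v1 x)\<^sup>2) * w x)"
proof -
  have p: "0 < 1 + (v1 x)\<^sup>2" by (simp add: add_pos_nonneg)
  have "(1 + (v1 x)\<^sup>2) powr (3/2) = (1 + (v1 x)\<^sup>2) powr (1 + 1/2)" by simp
  also have "\<dots> = (1 + (v1 x)\<^sup>2) * w x"
    unfolding powr_add using p by (simp add: powr_half_sqrt)
  finally show ?thesis by (simp add: H_fun_def deriv_r)
qed

lemma arctan_deriv: "((\<lambda>x. arctan (v1 x)) has_real_derivative v2 x / (1 + (v1 x)\<^sup>2)) (at x)"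
  by (auto intro!: derivative_eq_intros dv1 simp: divide_inverse)

lemma one_plus_pos: "1 + (v1 x)\<^sup>2 \<noteq> 0"
  by (metis add_pos_nonneg less_irrefl zero_le_power2 zero_less_one)

text \<open>Multiplication by \<open>w\<close> cancels the square roots in both curvature terms, and
  the only second-order term left is the derivative of \<open>arctan (v1 x)\<close>.\<close>

lemma G_op_eq: "G_op r x = h * w x - 1 / r x + v2 x / (1 + (v1 x)\<^sup>2)"
proof -
  have "w x \<noteq> 0" "r x \<noteq> 0" using w_bounds(1)[of x] r_bounds(4)[of x] by linarith+
  then show ?thesis
    unfolding G_op_def H_fun_eq deriv_r by (simp add: right_diff_distrib)
qed

lemma cont_G: "continuous_on UNIV (G_op r)"
proof -
  have "r x \<noteq> 0" for x using r_bounds[of x] by auto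
  then show ?thesis unfolding G_op_eq[abs_def]
    by (intro continuous_intros cont_v cont_v1 cont_v2 ballI one_plus_pos)
qed

section \<open>Integral identities and the energy estimate\<close>

lemma arctan_integral: "((\<lambda>x. v1 x * arctan (v1 x)) has_integral torus_int (\<lambda>x. v1 x * arctan (v1 x))) {-pi..pi}"
  by (intro torus_integrable continuous_intros cont_v1)

lemma arctan_integral_bounds:
  "0 \<le> torus_int (\<lambda>x. v1 x * arctan (v1 x))"
  "torus_int (\<lambda>x. v1 x * arctan (v1 x)) \<le> dirichlet"
  using has_integral_nonneg[OF arctan_integral] has_integral_le[OF arctan_integral basic_integrals(5)]
    arctan_minus_id_bound by blast+

text \<open>Against the weight \<open>r * w\<close> the first curvature term integrates to
  \<open>2*pi\<close>, and the second is \<open>r\<close> times the derivative of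
  \<open>arctan v1\<close>. After integration by parts no second derivative is left, so
  \<open>h\<close> is controlled by the C1 norm.\<close>

lemma h_times_S: "h * S = 2 * pi + torus_int (\<lambda>x. v1 x * arctan (v1 x))"
proof -
  have "H_fun r x * r x * w x = 1 - r x * (v2 x / (1 + (v1 x)\<^sup>2))" for x
  proof -
    have "w x \<noteq> 0" "r x \<noteq> 0" using w_bounds(1)[of x] r_bounds(4)[of x] by linarith+
    then have "1 / (r x * w x) * r x * w x = 1"
      "v2 x / ((1 + (v1 x)\<^sup>2) * w x) * r x * w x = r x * (v2 x / (1 + (v1 x)\<^sup>2))" by simp_all
    then show ?thesis unfolding H_fun_eq left_diff_distrib by simp
  qed
  then have "h = torus_int (\<lambda>x. 1 - r x * (v2 x / (1 + (v1 x)\<^sup>2))) / S"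
    by (simp add: h_fun_def deriv_r)
  moreover have "((\<lambda>x. r x * (v2 x / (1 + (v1 x)\<^sup>2))) has_integral - torus_int (\<lambda>x. v1 x * arctan (v1 x))) {-pi..pi}"
    by (rule torus_by_parts) (auto intro!: derivative_eq_intros dv arctan_deriv cont_v1 simp: per)
  from has_integral_diff[OF torus_trig_integrals(1) this]
  have "torus_int (\<lambda>x. 1 - r x * (v2 x / (1 + (v1 x)\<^sup>2))) = 2 * pi + torus_int (\<lambda>x. v1 x * arctan (v1 x))"
    by (simp add: integral_unique)
  ultimately show ?thesis using S_bounds by simp
qed

lemma dirichlet_le: "dirichlet \<le> 2 * pi"
proof -
  have "(v1 x)\<^sup>2 \<le> 1" for x
    using small(2)[of x] e by (simp add: abs_square_le_1)
  then show ?thesis by (intro has_integral_le[OF basic_integrals(5) torus_trig_integrals(1)]) 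
qed

lemma h_bounds: "0 \<le> h" "h \<le> 4 / rs"
proof -
  have "h = (2 * pi + torus_int (\<lambda>x. v1 x * arctan (v1 x))) / S"
    using h_times_S S_bounds by (simp add: field_simps)
  moreover have "(2 * pi + torus_int (\<lambda>x. v1 x * arctan (v1 x))) / S \<le> (4 * pi) / (pi * rs)"
    using S_bounds rs arctan_integral_bounds dirichlet_le by (intro frac_le) auto
  ultimately show "0 \<le> h" "h \<le> 4 / rs"
    using S_bounds arctan_integral_bounds by auto
qed

lemma mass_le: "\<bar>mass\<bar> \<le> 2 * pi * e"
proof -
  have "v x \<le> e * 1" "- e * 1 \<le> v x" for x using small(1)[of x] by (auto simp: abs_le_iff)
  from has_integral_le[OF basic_integrals(1) has_integral_mult_right[OF torus_trig_integrals(1)] this(1)]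
    has_integral_le[OF has_integral_mult_right[OF torus_trig_integrals(1)] basic_integrals(1) this(2)]
  show ?thesis by (simp add: abs_le_iff mult_ac)
qed

text \<open>The linearization vanishes on constants, and this is the quantitative form:
  \<open>h\<close> compensates \<open>1/rs\<close> up to \<open>mass / (rs * S)\<close> and an error
  bounded through \<open>dirichlet\<close>. To leading order the square kept here cancels the
  contribution of the mean to \<open>growth_form / rs\<^sup>2\<close>.\<close>

lemma mass_term: "mass * (1/rs - h) \<ge> mass\<^sup>2 / (rs * S) - 2 * e / rs * dirichlet"
proof -
  have w1: "((\<lambda>x. (w x - 1) * (1 + v x / rs)) has_integral torus_int (\<lambda>x. (w x - 1) * (1 + v x / rs))) {-pi..pi}"
    using rs by (intro torus_integrable continuous_intros cont_v cont_v1) auto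
  have b: "0 \<le> (w x - 1) * (1 + v x / rs) \<and> (w x - 1) * (1 + v x / rs) \<le> (v1 x)\<^sup>2" for x
  proof -
    have "0 \<le> 1 + v x / rs" "1 + v x / rs \<le> 3/2" using r_bounds[of x] rs by (auto simp: field_simps)
    moreover have "(w x - 1) * (1 + v x / rs) \<le> (v1 x)\<^sup>2/2 * (3/2)"
      using calculation w_bounds[of x] by (intro mult_mono) auto
    moreover have "0 \<le> (w x - 1) * (1 + v x / rs)" using calculation w_bounds(1)[of x] by (intro mult_nonneg_nonneg) auto
    ultimately show ?thesis using zero_le_power2[of "v1 x"] by linarith
  qed
  \<comment> \<open>Both integrals lie between \<open>0\<close> and \<open>dirichlet\<close>, hence
    so does the absolute value of their difference.\<close>
  define R where "R = torus_int (\<lambda>x. (w x - 1) * (1 + v x / rs)) - torus_int (\<lambda>x. v1 x * arctan (v1 x))"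
  have "0 \<le> torus_int (\<lambda>x. (w x - 1) * (1 + v x / rs))" "torus_int (\<lambda>x. (w x - 1) * (1 + v x / rs)) \<le> dirichlet"
    using has_integral_nonneg[OF w1] has_integral_le[OF w1 basic_integrals(5)] b by blast+
  then have R: "\<bar>R\<bar> \<le> dirichlet" using arctan_integral_bounds by (simp add: R_def abs_le_iff)
  \<comment> \<open>Splitting the integrand of \<open>S/rs\<close> isolates the part linear in
    \<open>v\<close>, whose integral is \<open>mass/rs\<close>, from one of second order in
    \<open>v1\<close>.\<close>
  have "((\<lambda>x. (1/rs) * (r x * w x) - (1/rs) * v x - 1) has_integral (1/rs) * S - (1/rs) * mass - 2 * pi) {-pi..pi}"
    by (intro has_integral_diff has_integral_mult_right S_integral basic_integrals torus_trig_integrals)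
  moreover have "(1/rs) * (r x * w x) - (1/rs) * v x - 1 = (w x - 1) * (1 + v x / rs)" for x
    using rs by (simp add: field_simps)
  ultimately have "((\<lambda>x. (w x - 1) * (1 + v x / rs)) has_integral (1/rs) * S - (1/rs) * mass - 2 * pi) {-pi..pi}"
    by (simp only:)
  then have "S/rs - h * S = mass/rs + R" unfolding R_def using h_times_S by (simp add: integral_unique)
  then have "mass * (mass/rs + R) = mass * (S/rs - h * S)" by simp
  also have "\<dots> = mass * (1/rs - h) * S" by (simp add: algebra_simps)
  finally have "mass * (1/rs - h) = mass * (mass/rs + R) / S"
    using S_bounds(3) by (metis less_irrefl nonzero_eq_divide_eq)
  also have "\<dots> = mass\<^sup>2 / (rs * S) + mass * R / S"
    using S_bounds rs by (simp add: field_simps power2_eq_square)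
  finally have "mass * (1/rs - h) = mass\<^sup>2 / (rs * S) + mass * R / S" .
  moreover have "\<bar>mass * R / S\<bar> \<le> (2 * pi * e) * dirichlet / (pi * rs)"
    unfolding abs_divide abs_mult using S_bounds R mass_le rs e by (intro frac_le mult_mono) auto
  then have "- (mass * R / S) \<le> (2 * pi * e) * dirichlet / (pi * rs)" by (rule abs_le_D2)
  then have "mass * R / S \<ge> - (2 * e / rs * dirichlet)" by simp
  ultimately show ?thesis by simp
qed

text \<open>Each term of \<open>G_op_eq\<close> is paired with \<open>q\<close>. The arctan term
  yields the Dirichlet pairing of \<open>q_integrals\<close>, the expansion of \<open>1 / r\<close>
  at \<open>rs\<close> yields \<open>growth_form / rs\<^sup>2\<close>, and its zeroth-order part
  joins \<open>h\<close> to give the expression in \<open>mass_term\<close>. All remainders cost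
  \<open>e\<close> times \<open>l2 + dirichlet\<close>.\<close>

lemma G_op_growth:
  "torus_int (\<lambda>x. G_op r x * q x) \<ge>
     growth_form / rs\<^sup>2 - (2 * first_mode - dirichlet) + mass\<^sup>2 / (rs * S)
       - e * (1 + 2 / rs ^ 3 + 4 / rs) * (l2 + dirichlet)"
proof -
  have e1: "((\<lambda>x. q x * (v2 x / (1 + (v1 x)\<^sup>2))) has_integral - torus_int (\<lambda>x. q1 x * arctan (v1 x))) {-pi..pi}"
    by (rule torus_by_parts[OF dq arctan_deriv q_cont(2)]) (simp_all add: per q_def)
  have r0: "r x \<noteq> 0" for x using r_bounds[of x] by auto
  have i1: "((\<lambda>x. q1 x * arctan (v1 x)) has_integral torus_int (\<lambda>x. q1 x * arctan (v1 x))) {-pi..pi}"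
    by (intro torus_integrable continuous_intros cont_v1 q_cont)
  have i2: "((\<lambda>x. q x / r x) has_integral torus_int (\<lambda>x. q x / r x)) {-pi..pi}"
    by (intro torus_integrable continuous_intros cont_v q_cont ballI r0)
  have i3: "((\<lambda>x. q x * (w x - 1)) has_integral torus_int (\<lambda>x. q x * (w x - 1))) {-pi..pi}"
    by (intro torus_integrable continuous_intros cont_v1 q_cont)
  have "((\<lambda>x. h * (q x * (w x - 1)) + h * q x - q x / r x + q x * (v2 x / (1 + (v1 x)\<^sup>2))) has_integral
     h * torus_int (\<lambda>x. q x * (w x - 1)) + h * (- mass) - torus_int (\<lambda>x. q x / r x)
       + - torus_int (\<lambda>x. q1 x * arctan (v1 x))) {-pi..pi}"
    by (intro has_integral_add has_integral_diff has_integral_mult_right i3 i2 e1 q_integrals)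
  then have total: "torus_int (\<lambda>x. G_op r x * q x) = 
     h * torus_int (\<lambda>x. q x * (w x - 1)) + h * (- mass) - torus_int (\<lambda>x. q x / r x)
       + - torus_int (\<lambda>x. q1 x * arctan (v1 x))"
    unfolding G_op_eq by (intro integral_unique) (simp add: algebra_simps)

  have "q1 x * arctan (v1 x) \<le> q1 x * v1 x + e * ((1/2) * ((q1 x)\<^sup>2 + (v1 x)\<^sup>2))" for x
  proof -
    have "(v1 x)\<^sup>2 \<le> e\<^sup>2" using small(2)[of x] by (simp add: abs_le_square_iff[symmetric] e less_imp_le)
    also have "e\<^sup>2 \<le> e" using e by (simp add: power2_eq_square mult_left_le)
    finally have "(v1 x)\<^sup>2 * \<bar>v1 x\<bar> \<le> e * \<bar>v1 x\<bar>" by (intro mult_right_mono) auto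
    then have "\<bar>q1 x * (arctan (v1 x) - v1 x)\<bar> \<le> e * (((q1 x)\<^sup>2 + (v1 x)\<^sup>2)/2)"
      using arctan_minus_id_bound(1)[of "v1 x"] e by (intro abs_mult_le_half_squares) auto
    from abs_le_D1[OF this] show ?thesis by (simp add: right_diff_distrib)
  qed
  moreover have "((\<lambda>x. q1 x * v1 x + e * ((1/2) * ((q1 x)\<^sup>2 + (v1 x)\<^sup>2))) has_integral
     (2 * first_mode - dirichlet) + e * ((1/2) * (dirichlet + dirichlet))) {-pi..pi}"
    by (intro has_integral_add has_integral_mult_right q_integrals basic_integrals)
  ultimately have E1: "torus_int (\<lambda>x. q1 x * arctan (v1 x)) \<le> (2 * first_mode - dirichlet) + e * dirichlet"
    using has_integral_le[OF i1] by fastforce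

  \<comment> \<open>The reciprocal \<open>1 / r x\<close> is expanded at \<open>rs\<close> with
    exact second-order remainder. The constant arises from \<open>r x \<ge> rs/2\<close> in the
    denominator \<open>rs\<^sup>2 * r x\<close>.\<close>
  define c where "c = 2 / rs ^ 3"
  have "q x / r x \<le> (1/rs) * q x - (1/rs\<^sup>2) * (q x * v x) + (e * c) * ((1/2) * ((q x)\<^sup>2 + (v x)\<^sup>2))" for x
  proof -
    have eq: "1 / r x = 1/rs - v x / rs\<^sup>2 + (v x)\<^sup>2 / (rs\<^sup>2 * r x)"
    proof -
      have "1 / z = 1/rs - (z - rs) / rs\<^sup>2 + (z - rs)\<^sup>2 / (rs\<^sup>2 * z)" if "z \<noteq> 0" for z
        using that rs by (simp add: field_simps power2_eq_square)
      from this[OF r0[of x]] show ?thesis by simp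
    qed
    have "\<bar>(v x)\<^sup>2 / (rs\<^sup>2 * r x)\<bar> = \<bar>v x\<bar> * \<bar>v x\<bar> / (rs\<^sup>2 * r x)"
      using r_bounds[of x] by (simp add: abs_mult power2_eq_square)
    also have "\<dots> \<le> (e * \<bar>v x\<bar>) / (rs\<^sup>2 * (rs/2))"
      using r_bounds[of x] rs small(1)[of x] by (intro frac_le mult_mono) auto
    also have "\<dots> = e * c * \<bar>v x\<bar>" using rs by (simp add: c_def power2_eq_square power3_eq_cube)
    finally have "\<bar>q x * ((v x)\<^sup>2 / (rs\<^sup>2 * r x))\<bar> \<le> e * c * (((q x)\<^sup>2 + (v x)\<^sup>2)/2)"
      using e rs by (intro abs_mult_le_half_squares) (auto simp: c_def)
    then have b: "q x * ((v x)\<^sup>2 / (rs\<^sup>2 * r x)) \<le> e * c * (((q x)\<^sup>2 + (v x)\<^sup>2)/2)" by (rule abs_le_D1)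
    have "q x / r x = q x * (1 / r x)" by simp
    also have "\<dots> = (1/rs) * q x - (1/rs\<^sup>2) * (q x * v x) + q x * ((v x)\<^sup>2 / (rs\<^sup>2 * r x))"
      unfolding eq by (simp add: distrib_left right_diff_distrib)
    finally show ?thesis using b by simp
  qed
  moreover have "((\<lambda>x. (1/rs) * q x - (1/rs\<^sup>2) * (q x * v x) + (e * c) * ((1/2) * ((q x)\<^sup>2 + (v x)\<^sup>2))) has_integral
     (1/rs) * (- mass) - (1/rs\<^sup>2) * growth_form + (e * c) * ((1/2) * (l2 + l2))) {-pi..pi}"
    by (intro has_integral_add has_integral_diff has_integral_mult_right q_integrals basic_integrals)
  ultimately have E2: "torus_int (\<lambda>x. q x / r x) \<le> (1/rs) * (- mass) - (1/rs\<^sup>2) * growth_form + (e * c) * ((1/2) * (l2 + l2))"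
    using has_integral_le[OF i2] by blast

  have "(- e) * ((1/2) * ((q x)\<^sup>2 + (v1 x)\<^sup>2)) \<le> q x * (w x - 1)" for x
  proof -
    have "\<bar>q x * (w x - 1)\<bar> \<le> e * (((q x)\<^sup>2 + (v1 x)\<^sup>2)/2)"
      using w_bounds[of x] e by (intro abs_mult_le_half_squares) auto
    then show ?thesis by (simp add: abs_le_iff)
  qed
  moreover have "((\<lambda>x. (- e) * ((1/2) * ((q x)\<^sup>2 + (v1 x)\<^sup>2))) has_integral (- e) * ((1/2) * (l2 + dirichlet))) {-pi..pi}"
    by (intro has_integral_add has_integral_mult_right q_integrals basic_integrals)
  ultimately have "(- e) * ((1/2) * (l2 + dirichlet)) \<le> torus_int (\<lambda>x. q x * (w x - 1))"
    using has_integral_le[OF _ i3] by blast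
  then have "h * ((- e) * ((1/2) * (l2 + dirichlet))) \<le> h * torus_int (\<lambda>x. q x * (w x - 1))"
    using h_bounds by (intro mult_left_mono)
  moreover have "h * (e * ((1/2) * (l2 + dirichlet))) \<le> 4/rs * (e * ((1/2) * (l2 + dirichlet)))"
    using h_bounds nonneg e by (intro mult_right_mono) auto
  ultimately have E3: "h * torus_int (\<lambda>x. q x * (w x - 1)) \<ge> - (2/rs * (e * (l2 + dirichlet)))"
    by simp

  \<comment> \<open>The errors are brought to the common factor \<open>l2 + dirichlet\<close>; the
    \<open>4 / rs\<close> consists of \<open>2 / rs\<close> from \<open>mass_term\<close> and
    \<open>2 / rs\<close> from \<open>E3\<close>.\<close>
  have "e * dirichlet \<le> e * (l2 + dirichlet)" "e * c * l2 \<le> e * c * (l2 + dirichlet)"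
    "2 * e / rs * dirichlet \<le> 2 * e / rs * (l2 + dirichlet)"
    using nonneg e rs by (intro mult_left_mono; simp add: c_def)+
  moreover have "e * (1 + c + 4 / rs) * (l2 + dirichlet) = e * (l2 + dirichlet) + e * c * (l2 + dirichlet)
     + 2 * e / rs * (l2 + dirichlet) + 2/rs * (e * (l2 + dirichlet))" using rs by (simp add: field_simps)
  moreover have "mass * (1/rs - h) = (1/rs) * mass - h * mass" by (simp add: algebra_simps)
  ultimately show ?thesis unfolding c_def[symmetric]
    using total E1 E2 E3 mass_term by simp
qed

text \<open>The rate \<open>1 / rs\<^sup>2 - \<beta>\<close> lies below the eigenvalue
  \<open>1 / rs\<^sup>2 - 1\<close> of the first mode, which gives room there. Since
  \<open>\<beta> < 2\<close>, the modes beyond, whose Dirichlet integral is at least twice their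
  squared norm, have room as well, and assumption \<open>S\<close> provides it on constants. The
  margin \<open>k\<close> absorbs the nonlinear errors.\<close>

lemma growth_form_coercive:
  assumes b: "1 < \<beta>" "\<beta> < 2" and k: "0 < k" "k \<le> (\<beta> - 1)/2" "k \<le> (2 - \<beta>)/4"
    and S: "(\<beta> + k) * (rs * ((rs + e) * (1 + e))) \<le> 1" and K: "e * (1 + 2 / rs ^ 3 + 4 / rs) \<le> k"
  shows "torus_int (\<lambda>x. G_op r x * q x) \<ge> (1 / rs\<^sup>2 - \<beta>) * growth_form"
proof -
  \<comment> \<open>\<open>X0\<close>, \<open>first_mode\<close> and \<open>X2\<close> are the
    shares of the constant, first and higher modes in \<open>l2\<close>; \<open>Y2\<close> is the
    share of the higher modes in \<open>dirichlet\<close>.\<close>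
  define X0 X2 Y2 where "X0 = mass\<^sup>2 / (2*pi)" and "X2 = l2 - first_mode - X0" and "Y2 = dirichlet - first_mode"
  have Y2: "2 * X2 \<le> Y2" using higher_modes_wirtinger by (simp add: X0_def X2_def Y2_def)
  have "(\<beta> + k) * (rs * S) \<le> (\<beta> + k) * (rs * (2 * pi * ((rs + e) * (1 + e))))"
    using S_bounds b k rs by (intro mult_left_mono) auto
  also have "\<dots> = ((\<beta> + k) * (rs * ((rs + e) * (1 + e)))) * (2 * pi)" by simp
  also have "\<dots> \<le> 1 * (2 * pi)" by (intro mult_right_mono S) simp
  finally have "mass\<^sup>2 * ((\<beta> + k) * (rs * S)) \<le> mass\<^sup>2 * (2 * pi)" by (intro mult_left_mono) auto
  then have m: "(\<beta> + k) * X0 \<le> mass\<^sup>2 / (rs * S)"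
    using S_bounds rs by (simp add: X0_def field_simps)
  have "e * (1 + 2 / rs ^ 3 + 4 / rs) * (l2 + dirichlet) \<le> k * (l2 + dirichlet)"
    using nonneg by (intro mult_right_mono K) auto
  then have G: "torus_int (\<lambda>x. G_op r x * q x) \<ge>
     growth_form / rs\<^sup>2 - (2 * first_mode - dirichlet) + (\<beta> + k) * X0 - k * (l2 + dirichlet)"
    using G_op_growth m by linarith
  have "(1 / rs\<^sup>2 - \<beta>) * growth_form = growth_form / rs\<^sup>2 - \<beta> * growth_form"
    by (simp add: left_diff_distrib)
  moreover have "\<beta> * growth_form - (2 * first_mode - dirichlet) + (\<beta> + k) * X0 - k * (l2 + dirichlet)
     = (\<beta> - 1 - 2 * k) * first_mode + (Y2 - \<beta> * X2 - k * (X2 + Y2))"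
    unfolding growth_form_def X2_def Y2_def by (simp add: algebra_simps)
  moreover have "0 \<le> (\<beta> - 1 - 2 * k) * first_mode" using k nonneg by simp
  \<comment> \<open>Replacing \<open>Y2\<close> by its lower bound \<open>2 * X2\<close> leaves
    \<open>(2 - \<beta> - 3 * k) * X2\<close>, which \<open>k \<le> (2 - \<beta>)/4\<close> makes
    nonnegative.\<close>
  moreover have "0 \<le> Y2 - \<beta> * X2 - k * (X2 + Y2)"
  proof -
    have "0 \<le> X2" using bessel_first_modes by (simp add: X0_def X2_def)
    then have "0 \<le> (2 - \<beta> - 3 * k) * X2" using k by (intro mult_nonneg_nonneg) auto
    moreover have "(1 - k) * (2 * X2) \<le> (1 - k) * Y2" using b k Y2 by (intro mult_left_mono) auto
    ultimately show ?thesis by (simp add: algebra_simps)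
  qed
  ultimately show ?thesis using G by linarith
qed

end

subsection \<open>Bounded Hoelder functions\<close>

text \<open>Explicit bounds replace suprema here, because the supremum of an unbounded set of reals
  carries no information.\<close>

definition bdd_holder :: "real \<Rightarrow> (real \<Rightarrow> real) \<Rightarrow> bool" where
  "bdd_holder a f \<longleftrightarrow> (\<exists>C\<ge>0. (\<forall>x. \<bar>f x\<bar> \<le> C) \<and> (\<forall>x y. \<bar>f x - f y\<bar> \<le> C * \<bar>x - y\<bar> powr a))"

lemma bdd_holderI:
  assumes "\<And>x. \<bar>f x\<bar> \<le> B" "\<And>x y. \<bar>f x - f y\<bar> \<le> C * \<bar>x - y\<bar> powr a"
  shows "bdd_holder a f"
  unfolding bdd_holder_def
proof (intro exI conjI allI)
  have "0 \<le> B" using assms(1)[of 0] by linarith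
  then show "0 \<le> max B C" by simp
  show "\<bar>f x\<bar> \<le> max B C" for x using assms(1)[of x] by simp
  show "\<bar>f x - f y\<bar> \<le> max B C * \<bar>x - y\<bar> powr a" for x y
    by (rule order_trans[OF assms(2)]) (simp add: mult_right_mono)
qed

lemma bdd_holderE:
  assumes "bdd_holder a f"
  obtains C where "0 \<le> C" "\<And>x. \<bar>f x\<bar> \<le> C" "\<And>x y. \<bar>f x - f y\<bar> \<le> C * \<bar>x - y\<bar> powr a"
  using assms unfolding bdd_holder_def by blast

lemma bdd_holder_const: "bdd_holder a (\<lambda>x. c)"
  by (rule bdd_holderI[of _ "\<bar>c\<bar>" 0]) auto

lemma bdd_holder_lipschitz_comp:
  assumes "bdd_holder a f" "\<And>x. \<bar>g x\<bar> \<le> B" "\<And>x y. \<bar>g x - g y\<bar> \<le> L * \<bar>f x - f y\<bar>" "0 \<le> L"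
  shows "bdd_holder a g"
proof -
  from assms(1) obtain C where C: "\<And>x y. \<bar>f x - f y\<bar> \<le> C * \<bar>x - y\<bar> powr a" by (rule bdd_holderE) blast
  show ?thesis
  proof (rule bdd_holderI[OF assms(2)])
    show "\<bar>g x - g y\<bar> \<le> (L * C) * \<bar>x - y\<bar> powr a" for x y
      using order_trans[OF assms(3) mult_left_mono[OF C assms(4)]] by (simp add: mult.assoc)
  qed
qed

lemma bdd_holder_cmult: "bdd_holder a f \<Longrightarrow> bdd_holder a (\<lambda>x. c * f x)"
proof -
  assume f: "bdd_holder a f"
  then obtain C where C: "\<And>x. \<bar>f x\<bar> \<le> C" by (rule bdd_holderE) blast
  show ?thesis
  proof (rule bdd_holder_lipschitz_comp[OF f, of _ "\<bar>c\<bar> * C" "\<bar>c\<bar>"])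
    show "\<bar>c * f x\<bar> \<le> \<bar>c\<bar> * C" for x using C[of x] by (simp add: abs_mult mult_left_mono)
    show "\<bar>c * f x - c * f y\<bar> \<le> \<bar>c\<bar> * \<bar>f x - f y\<bar>" for x y
      by (simp add: right_diff_distrib[symmetric] abs_mult)
  qed simp
qed

lemma bdd_holder_add:
  assumes "bdd_holder a f" "bdd_holder a g"
  shows "bdd_holder a (\<lambda>x. f x + g x)"
proof -
  from assms(1) obtain C where C: "\<And>x. \<bar>f x\<bar> \<le> C" "\<And>x y. \<bar>f x - f y\<bar> \<le> C * \<bar>x - y\<bar> powr a" by (rule bdd_holderE) blast
  from assms(2) obtain D where D: "\<And>x. \<bar>g x\<bar> \<le> D" "\<And>x y. \<bar>g x - g y\<bar> \<le> D * \<bar>x - y\<bar> powr a" by (rule bdd_holderE) blast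
  show ?thesis
  proof (rule bdd_holderI)
    show "\<bar>f x + g x\<bar> \<le> C + D" for x using C(1)[of x] D(1)[of x] by linarith
    show "\<bar>f x + g x - (f y + g y)\<bar> \<le> (C + D) * \<bar>x - y\<bar> powr a" for x y
      using C(2)[of x y] D(2)[of x y] unfolding distrib_right by linarith
  qed
qed

lemma bdd_holder_diff:
  "bdd_holder a f \<Longrightarrow> bdd_holder a g \<Longrightarrow> bdd_holder a (\<lambda>x. f x - g x)"
  using bdd_holder_add[of a f "\<lambda>x. -1 * g x"] bdd_holder_cmult[of a g "-1"] by simp

lemma bdd_holder_mult:
  assumes "bdd_holder a f" "bdd_holder a g"
  shows "bdd_holder a (\<lambda>x. f x * g x)"
proof -
  from assms(1) obtain C where C: "0 \<le> C" "\<And>x. \<bar>f x\<bar> \<le> C" "\<And>x y. \<bar>f x - f y\<bar> \<le> C * \<bar>x - y\<bar> powr a" by (rule bdd_holderE) blast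
  from assms(2) obtain D where D: "0 \<le> D" "\<And>x. \<bar>g x\<bar> \<le> D" "\<And>x y. \<bar>g x - g y\<bar> \<le> D * \<bar>x - y\<bar> powr a" by (rule bdd_holderE) blast
  show ?thesis
  proof (rule bdd_holderI)
    show "\<bar>f x * g x\<bar> \<le> C * D" for x using C D unfolding abs_mult by (intro mult_mono) auto
    show "\<bar>f x * g x - f y * g y\<bar> \<le> (2 * C * D) * \<bar>x - y\<bar> powr a" for x y
    proof -
      have "f x * g x - f y * g y = f x * (g x - g y) + (f x - f y) * g y" by (simp add: algebra_simps)
      then have "\<bar>f x * g x - f y * g y\<bar> \<le> \<bar>f x\<bar> * \<bar>g x - g y\<bar> + \<bar>f x - f y\<bar> * \<bar>g y\<bar>"
        by (metis abs_mult abs_triangle_ineq)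
      also have "\<dots> \<le> C * (D * \<bar>x - y\<bar> powr a) + (C * \<bar>x - y\<bar> powr a) * D"
        using C D by (intro add_mono mult_mono) auto
      finally show ?thesis by (simp add: algebra_simps)
    qed
  qed
qed

text \<open>For points at distance at most \<open>1\<close> the powers compare; for distant points
  the sup bound gives \<open>2 * C\<close>, and the power with exponent \<open>b\<close> is at least
  \<open>1\<close>.\<close>

lemma bdd_holder_mono:
  assumes "bdd_holder a f" "0 \<le> b" "b \<le> a"
  shows "bdd_holder b f"
proof -
  from assms(1) obtain C where C: "0 \<le> C" "\<And>x. \<bar>f x\<bar> \<le> C" "\<And>x y. \<bar>f x - f y\<bar> \<le> C * \<bar>x - y\<bar> powr a" by (rule bdd_holderE) blast
  show ?thesis
  proof (rule bdd_holderI[OF C(2)])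
    show "\<bar>f x - f y\<bar> \<le> (2 * C) * \<bar>x - y\<bar> powr b" for x y
    proof (cases "\<bar>x - y\<bar> \<le> 1")
      case True
      have "\<bar>x - y\<bar> powr a \<le> \<bar>x - y\<bar> powr b" using True assms by (intro powr_mono') auto
      then have "C * \<bar>x - y\<bar> powr a \<le> C * \<bar>x - y\<bar> powr b" using C(1) by (rule mult_left_mono)
      moreover have "0 \<le> C * \<bar>x - y\<bar> powr b" using C(1) by simp
      ultimately show ?thesis using C(3)[of x y] by simp
    next
      case False
      have "\<bar>f x - f y\<bar> \<le> 2 * C" using C(2)[of x] C(2)[of y] by linarith
      also have "\<dots> \<le> 2 * C * \<bar>x - y\<bar> powr b"
        using False assms C(1) ge_one_powr_ge_zero[of "\<bar>x - y\<bar>" b] by (simp add: mult_le_cancel_left1)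
      finally show ?thesis .
    qed
  qed
qed

lemma bdd_holder_C1:
  assumes "\<And>x. (f has_real_derivative f' x) (at x)" "\<And>x. \<bar>f x\<bar> \<le> B" "\<And>x. \<bar>f' x\<bar> \<le> C" "0 \<le> a" "a \<le> 1"
  shows "bdd_holder a f"
proof (rule bdd_holder_mono[OF bdd_holderI[OF assms(2)]])
  show "\<bar>f x - f y\<bar> \<le> C * \<bar>x - y\<bar> powr 1" for x y
    using field_differentiable_bound[of UNIV f f' C x y] assms by simp
qed (use assms in auto)

lemma bdd_holder_quot:
  assumes "bdd_holder a f"
  shows "bdd_above (holder_quot a f)" "0 \<le> holder_seminorm a f"
proof -
  from assms obtain C where C: "0 \<le> C" "\<And>x. \<bar>f x\<bar> \<le> C" "\<And>x y. \<bar>f x - f y\<bar> \<le> C * \<bar>x - y\<bar> powr a" by (rule bdd_holderE) blast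
  have "z \<le> C" if "z \<in> holder_quot a f" for z
    using that C(3) unfolding holder_quot_def by (auto simp: divide_le_eq)
  then show b: "bdd_above (holder_quot a f)" by (rule bdd_aboveI)
  have "\<bar>f 0 - f 1\<bar> / \<bar>0 - 1\<bar> powr a \<in> holder_quot a f" unfolding holder_quot_def
    by (intro CollectI exI[of _ 0] exI[of _ 1]) simp
  then have "\<bar>f 0 - f 1\<bar> / \<bar>0 - 1\<bar> powr a \<le> holder_seminorm a f" unfolding holder_seminorm_def
    by (intro cSup_upper b)
  then show "0 \<le> holder_seminorm a f" by (rule order_trans[rotated]) simp
qed

lemma bdd_holder_from_quot:
  assumes "bdd_above (holder_quot a f)" "\<And>x. \<bar>f x\<bar> \<le> B"
  shows "bdd_holder a f"
proof -
  from assms(1) obtain C where C: "\<And>z. z \<in> holder_quot a f \<Longrightarrow> z \<le> C" by (auto simp: bdd_above_def)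
  show ?thesis
  proof (rule bdd_holderI[OF assms(2)])
    show "\<bar>f x - f y\<bar> \<le> C * \<bar>x - y\<bar> powr a" for x y
    proof (cases "x = y")
      case False
      then have "\<bar>f x - f y\<bar> / \<bar>x - y\<bar> powr a \<le> C" by (intro C) (auto simp: holder_quot_def)
      then show ?thesis using False by (simp add: divide_le_eq)
    qed simp
  qed
qed

section \<open>Consequences of the Hoelder norms for periodic functions\<close>

lemma sup_norm_upper: "(\<And>x. \<bar>f x\<bar> \<le> B) \<Longrightarrow> \<bar>f x\<bar> \<le> sup_norm f"
  unfolding sup_norm_def by (intro cSUP_upper bdd_aboveI2) auto

lemma sup_norm_nonneg: "(\<And>x. \<bar>f x\<bar> \<le> B) \<Longrightarrow> 0 \<le> sup_norm f"
  using sup_norm_upper[of f B 0] abs_ge_zero order_trans by blast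

text \<open>Through this bound convergence in \<open>hnorm a\<close> becomes uniform convergence.
  The regularity of \<open>f\<close> makes the seminorm a genuine, nonnegative supremum, so that it
  can be discarded.\<close>

lemma hnorm_unit_upper:
  assumes "bdd_holder a f" "0 < a" "a < 1"
  shows "\<bar>f x\<bar> \<le> hnorm a f"
proof -
  from assms(1) obtain C where C: "\<And>x. \<bar>f x\<bar> \<le> C" by (rule bdd_holderE) blast
  have "\<lfloor>a\<rfloor> = 0" using assms by (simp add: floor_eq_iff)
  then show ?thesis using sup_norm_upper[of f C x, OF C] bdd_holder_quot(2)[OF assms(1)] by (simp add: hnorm_def)
qed

lemma periodic2pi_int: "periodic2pi f \<Longrightarrow> f (x + 2 * pi * of_int n) = f x"
proof (induction n rule: int_induct[where k = 0])
  case (step1 i)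
  then show ?case unfolding periodic2pi_def
    by (metis (no_types, opaque_lifting) add.assoc distrib_left mult.right_neutral of_int_1 of_int_add)
next
  case (step2 i)
  have "f (x + 2 * pi * of_int (i - 1)) = f (x + 2 * pi * of_int (i - 1) + 2 * pi)"
    using step2 unfolding periodic2pi_def by metis
  also have "\<dots> = f (x + 2 * pi * of_int i)" by (simp add: algebra_simps)
  finally show ?case using step2 by simp
qed simp

lemma periodic2pi_bounded:
  assumes "periodic2pi f" "continuous_on UNIV f"
  obtains B where "\<And>x. \<bar>f x\<bar> \<le> B"
proof -
  have "bounded (f ` {0..2*pi})"
    by (intro compact_imp_bounded compact_continuous_image continuous_on_subset[OF assms(2)]) auto
  then obtain B where B: "\<And>x. x \<in> {0..2*pi} \<Longrightarrow> \<bar>f x\<bar> \<le> B" unfolding bounded_real by blast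
  show ?thesis
  proof (rule that)
    fix x :: real
    define n where "n = \<lfloor>x / (2*pi)\<rfloor>"
    have "of_int n \<le> x / (2*pi)" "x / (2*pi) < of_int n + 1" unfolding n_def by linarith+
    then have "x + 2 * pi * of_int (-n) \<in> {0..2*pi}" by (simp add: field_simps)
    from B[OF this] show "\<bar>f x\<bar> \<le> B" unfolding periodic2pi_int[OF assms(1)] .
  qed
qed

lemma periodic2pi_deriv:
  assumes "periodic2pi f" "\<And>x. (f has_real_derivative f' x) (at x)"
  shows "periodic2pi f'"
  unfolding periodic2pi_def
proof
  fix x
  have "((\<lambda>y. f (y + 2*pi)) has_real_derivative f' (x + 2*pi)) (at x)"
    using assms(2)[of "x + 2*pi"] by (simp add: DERIV_shift)
  moreover have "(\<lambda>y. f (y + 2*pi)) = f" using assms(1) by (auto simp: periodic2pi_def)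
  ultimately show "f' (x + 2*pi) = f' x" using assms(2)[of x] DERIV_unique by metis
qed

lemma periodic2pi_endpoints: "periodic2pi f \<Longrightarrow> f (-pi) = f pi"
  unfolding periodic2pi_def by (metis add.commute add_uminus_conv_diff mult_2 add_diff_cancel)

lemma C_holder_unitD:
  assumes "C_holder a f" "0 < a" "a < 1"
  shows "bdd_holder a f" "continuous_on UNIV f"
proof -
  have [simp]: "\<lfloor>a\<rfloor> = 0" using assms by (simp add: floor_eq_iff)
  have p: "periodic2pi f" and c: "continuous_on UNIV f" and h: "bdd_above (holder_quot a f)"
    using assms(1) by (simp_all add: C_holder_def Ck_per_def)
  from p c obtain B where "\<And>x. \<bar>f x\<bar> \<le> B" using periodic2pi_bounded by blast
  then show "bdd_holder a f" using h bdd_holder_from_quot by blast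
  show "continuous_on UNIV f" by fact
qed

lemma C_holder_2D:
  assumes "C_holder (2 + a) f" "0 < a" "a < 1"
  shows "periodic2pi f" "periodic2pi (deriv f)"
    "(f has_real_derivative deriv f x) (at x)" "(deriv f has_real_derivative deriv (deriv f) x) (at x)"
    "continuous_on UNIV (deriv (deriv f))" "bdd_holder a (deriv (deriv f))"
proof -
  have k: "\<lfloor>2 + a\<rfloor> = 2" using assms by (simp add: floor_eq_iff)
  have "Ck_per 2 f" and h: "bdd_above (holder_quot a ((deriv ^^ 2) f))"
    using assms(1) unfolding C_holder_def k by simp_all
  then have p: "periodic2pi f" and d: "\<And>j x. j < 2 \<Longrightarrow> (deriv ^^ j) f differentiable at x"
    and c: "continuous_on UNIV (deriv (deriv f))"
    by (auto simp: Ck_per_def numeral_2_eq_2)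
  have d0: "(f has_real_derivative deriv f x) (at x)" for x
    using d[of 0 x] by (simp add: DERIV_deriv_iff_real_differentiable)
  have d1: "(deriv f has_real_derivative deriv (deriv f) x) (at x)" for x
    using d[of 1 x] by (simp add: DERIV_deriv_iff_real_differentiable)
  show "periodic2pi f" by fact
  show p1: "periodic2pi (deriv f)" by (rule periodic2pi_deriv[OF p d0])
  have p2: "periodic2pi (deriv (deriv f))" by (rule periodic2pi_deriv[OF p1 d1])
  show "(f has_real_derivative deriv f x) (at x)" "(deriv f has_real_derivative deriv (deriv f) x) (at x)" by fact+
  show "continuous_on UNIV (deriv (deriv f))" by fact
  from p2 c obtain B where "\<And>x. \<bar>deriv (deriv f) x\<bar> \<le> B" using periodic2pi_bounded by blast
  then show "bdd_holder a (deriv (deriv f))" using h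
    by (intro bdd_holder_from_quot[of a _ B]) (auto simp: numeral_2_eq_2)
qed

text \<open>This turns closeness in the stability norm into the C1 smallness demanded by
  \<open>near_cylinder\<close>. The integer part of \<open>\<sigma>\<close> is \<open>1\<close> or
  \<open>2\<close>; regularity of order \<open>2 + a\<close> makes all summands of the norm genuine
  and nonnegative in either case.\<close>

lemma hnorm_controls_C1:
  assumes f: "C_holder (2 + a) f" "0 < a" "a < 1" and s: "1 \<le> \<sigma>" "\<sigma> \<le> 2 + a"
  shows "\<bar>f x - c\<bar> \<le> hnorm \<sigma> (\<lambda>x. f x - c)" "\<bar>deriv f x\<bar> \<le> hnorm \<sigma> (\<lambda>x. f x - c)"
proof -
  note D = C_holder_2D[OF f]
  define g where "g x = f x - c" for x
  have dg: "(g has_real_derivative deriv f x) (at x)" for x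
    unfolding g_def by (auto intro!: derivative_eq_intros D)
  then have g1: "deriv g = deriv f" by (auto intro!: ext DERIV_imp_deriv)
  have cg: "continuous_on UNIV g" using dg by (meson DERIV_isCont continuous_at_imp_continuous_on)
  have c1: "continuous_on UNIV (deriv f)" using D(4) by (meson DERIV_isCont continuous_at_imp_continuous_on)
  have pg: "periodic2pi g" using D(1) by (simp add: periodic2pi_def g_def)
  obtain B0 where B0: "\<And>x. \<bar>g x\<bar> \<le> B0" using periodic2pi_bounded[OF pg cg] by blast
  obtain B1 where B1: "\<And>x. \<bar>deriv f x\<bar> \<le> B1" using periodic2pi_bounded[OF D(2) c1] by blast
  obtain B2 where B2: "\<And>x. \<bar>deriv (deriv f) x\<bar> \<le> B2" using D(6) by (meson bdd_holderE)
  note s0 = sup_norm_upper[of g, OF B0] and s1 = sup_norm_upper[of "deriv f", OF B1]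
    and s2 = sup_norm_nonneg[of "deriv (deriv f)", OF B2]
    and n0 = sup_norm_nonneg[of g, OF B0] and n1 = sup_norm_nonneg[of "deriv f", OF B1]
  have "sup_norm g + sup_norm (deriv f) \<le> hnorm \<sigma> g"
  proof (cases "\<sigma> < 2")
    case True
    then have k: "\<lfloor>\<sigma>\<rfloor> = 1" using s by (simp add: floor_eq_iff)
    have "bdd_holder (\<sigma> - 1) (deriv f)" using bdd_holder_C1[OF D(4) B1 B2] True s by simp
    from bdd_holder_quot(2)[OF this] show ?thesis unfolding hnorm_def k by (simp add: g1)
  next
    case False
    then have k: "\<lfloor>\<sigma>\<rfloor> = 2" using s f by (simp add: floor_eq_iff)
    have "bdd_holder (\<sigma> - 2) (deriv (deriv f))" using bdd_holder_mono[OF D(6)] False s by simp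
    from bdd_holder_quot(2)[OF this] show ?thesis unfolding hnorm_def k using s2 by (simp add: g1 numeral_2_eq_2)
  qed
  then show "\<bar>f x - c\<bar> \<le> hnorm \<sigma> (\<lambda>x. f x - c)" "\<bar>deriv f x\<bar> \<le> hnorm \<sigma> (\<lambda>x. f x - c)"
    using s0[of x] s1[of x] n0 n1 unfolding g_def[abs_def] by linarith+
qed

lemma abs_diff_sqrt_le:
  fixes a b :: real
  assumes "1 \<le> a" "1 \<le> b"
  shows "\<bar>sqrt a - sqrt b\<bar> \<le> \<bar>a - b\<bar>"
proof -
  have "a - b = (sqrt a - sqrt b) * (sqrt a + sqrt b)" using assms by (simp add: algebra_simps)
  then have "\<bar>a - b\<bar> = \<bar>sqrt a - sqrt b\<bar> * (sqrt a + sqrt b)" using assms by (simp add: abs_mult)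
  moreover have "1 \<le> sqrt a + sqrt b" using assms real_sqrt_ge_1_iff[of a] real_sqrt_ge_zero[of b] by linarith
  ultimately show ?thesis by (simp add: mult_le_cancel_left1)
qed

context near_cylinder
begin

text \<open>Without this, \<open>hnorm \<alpha>\<close> of the difference quotient minus \<open>G\<close> could be the junk supremum of an unbounded set,
  and its convergence to zero would say nothing.\<close>

lemma bdd_holder_G:
  assumes "bdd_holder a v2" "0 \<le> a" "a \<le> 1"
  shows "bdd_holder a (G_op r)"
proof -
  obtain B2 where B2: "\<And>x. \<bar>v2 x\<bar> \<le> B2" using assms(1) by (meson bdd_holderE)
  have h0: "bdd_holder a v" by (rule bdd_holder_C1[OF dv small assms(2,3)])
  have h1: "bdd_holder a v1" by (rule bdd_holder_C1[OF dv1 small(2) B2 assms(2,3)])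
  have sq: "\<bar>(v1 x)\<^sup>2 - (v1 y)\<^sup>2\<bar> \<le> 2 * \<bar>v1 x - v1 y\<bar>" for x y
  proof -
    have "\<bar>(v1 x)\<^sup>2 - (v1 y)\<^sup>2\<bar> = \<bar>v1 x + v1 y\<bar> * \<bar>v1 x - v1 y\<bar>"
      by (simp add: abs_mult[symmetric] power2_eq_square algebra_simps)
    also have "\<dots> \<le> 2 * \<bar>v1 x - v1 y\<bar>"
      using small(2)[of x] small(2)[of y] e by (intro mult_right_mono) auto
    finally show ?thesis .
  qed
  have hw: "bdd_holder a w"
  proof (rule bdd_holder_lipschitz_comp[OF h1])
    show "\<bar>w x\<bar> \<le> 1 + e" for x using w_bounds(1,3)[of x] by linarith
    show "\<bar>w x - w y\<bar> \<le> 2 * \<bar>v1 x - v1 y\<bar>" for x y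
      using abs_diff_sqrt_le[of "1 + (v1 x)\<^sup>2" "1 + (v1 y)\<^sup>2"] sq[of x y] by simp
  qed simp
  have hr: "bdd_holder a (\<lambda>x. 1 / r x)"
  proof (rule bdd_holder_lipschitz_comp[OF h0])
    show "\<bar>1 / r x\<bar> \<le> 1 / (rs/2)" for x
      using r_bounds[of x] rs frac_le[of 1 1 "rs/2" "r x"] by (simp add: abs_divide)
    show "\<bar>1 / r x - 1 / r y\<bar> \<le> 1 / ((rs/2) * (rs/2)) * \<bar>v x - v y\<bar>" for x y
    proof -
      have "1 / r x - 1 / r y = (v y - v x) / (r x * r y)"
        using r_bounds(4)[of x] r_bounds(4)[of y] by (simp add: field_simps)
      then have "\<bar>1 / r x - 1 / r y\<bar> = \<bar>v x - v y\<bar> / (r x * r y)"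
        using r_bounds(4)[of x] r_bounds(4)[of y] by (simp add: abs_mult abs_minus_commute)
      also have "\<dots> \<le> \<bar>v x - v y\<bar> / ((rs/2) * (rs/2))"
        using r_bounds[of x] r_bounds[of y] rs by (intro divide_left_mono mult_mono mult_pos_pos) auto
      finally show ?thesis by (simp add: mult.commute)
    qed
  qed (use rs in simp)
  have hq: "bdd_holder a (\<lambda>x. 1 / (1 + (v1 x)\<^sup>2))"
  proof (rule bdd_holder_lipschitz_comp[OF h1])
    have ge: "1 \<le> 1 + (v1 x)\<^sup>2" for x by simp
    have pos: "0 < 1 + (v1 x)\<^sup>2" for x by (rule less_le_trans[OF _ ge]) simp
    show "\<bar>1 / (1 + (v1 x)\<^sup>2)\<bar> \<le> 1" for x using pos[of x] by (simp add: abs_divide)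
    show "\<bar>1 / (1 + (v1 x)\<^sup>2) - 1 / (1 + (v1 y)\<^sup>2)\<bar> \<le> 2 * \<bar>v1 x - v1 y\<bar>" for x y
    proof -
      have "1 / (1 + (v1 x)\<^sup>2) - 1 / (1 + (v1 y)\<^sup>2) = ((v1 y)\<^sup>2 - (v1 x)\<^sup>2) / ((1 + (v1 x)\<^sup>2) * (1 + (v1 y)\<^sup>2))"
        using pos[of x] pos[of y] by (simp add: field_simps)
      then have "\<bar>1 / (1 + (v1 x)\<^sup>2) - 1 / (1 + (v1 y)\<^sup>2)\<bar> = \<bar>(v1 x)\<^sup>2 - (v1 y)\<^sup>2\<bar> / ((1 + (v1 x)\<^sup>2) * (1 + (v1 y)\<^sup>2))"
        using pos[of x] pos[of y] by (simp add: abs_mult abs_minus_commute)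
      also have "\<dots> \<le> \<bar>(v1 x)\<^sup>2 - (v1 y)\<^sup>2\<bar> / (1 * 1)"
        by (intro divide_left_mono mult_mono mult_pos_pos pos ge) auto
      finally show ?thesis using sq[of x y] by simp
    qed
  qed simp
  have "bdd_holder a (\<lambda>x. h * w x - 1 / r x + v2 x * (1 / (1 + (v1 x)\<^sup>2)))"
    by (intro bdd_holder_add bdd_holder_diff bdd_holder_cmult bdd_holder_mult hw hr hq assms)
  then show ?thesis unfolding G_op_eq[abs_def] by simp
qed

end

subsection \<open>Differentiating integrals in time\<close>

lemma bounded_torus_image: "bounded (k ` {-pi..pi})" if "continuous_on UNIV k" for k :: "real \<Rightarrow> real"
  by (intro compact_imp_bounded compact_continuous_image continuous_on_subset[OF that]) auto

lemma tendsto_torus_int: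
  assumes f: "\<forall>\<^sub>F s in F. continuous_on UNIV (f s)" and l: "continuous_on UNIV l"
    and u: "uniform_limit {-pi..pi} f l F"
  shows "((\<lambda>s. torus_int (f s)) \<longlongrightarrow> torus_int l) F"
proof (rule tendstoI)
  fix e :: real assume e: "0 < e"
  then have "0 < e / (4 * pi)" by simp
  with u have "\<forall>\<^sub>F s in F. \<forall>x\<in>{-pi..pi}. dist (f s x) (l x) < e / (4 * pi)"
    by (auto simp: uniform_limit_iff)
  with f show "\<forall>\<^sub>F s in F. dist (torus_int (f s)) (torus_int l) < e"
  proof eventually_elim
    case (elim s)
    have "((\<lambda>x. f s x - l x) has_integral torus_int (f s) - torus_int l) {-pi..pi}"
      using elim l by (intro has_integral_diff torus_integrable)
    moreover have "norm (f s x - l x) \<le> e / (4 * pi)" if "x \<in> {-pi..pi}" for x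
      using elim(2) that by (force simp: dist_norm)
    ultimately have "norm (torus_int (f s) - torus_int l) \<le> e / (4 * pi) * measure lborel {-pi..pi}"
      using e by (intro has_integral_bound_real[where f = "\<lambda>x. f s x - l x"]) auto
    also have "\<dots> = e / 2" by simp
    finally show ?case using e by (simp add: dist_norm)
  qed
qed

context
  fixes u :: "real \<Rightarrow> real \<Rightarrow> real" and g :: "real \<Rightarrow> real" and t :: real
  assumes t: "0 < t" and cu: "\<And>s. 0 < s \<Longrightarrow> continuous_on UNIV (u s)" and cg: "continuous_on UNIV g"
    and U: "uniform_limit {-pi..pi} (\<lambda>s x. (u s x - u t x) / (s - t)) g (at t)"
begin

private lemma eventually_pos: "\<forall>\<^sub>F s in at t. 0 < s \<and> s \<noteq> t"
proof -
  have "\<forall>\<^sub>F s in at t. s \<in> {0<..}" by (rule eventually_at_in_open') (use t in auto)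
  moreover have "\<forall>\<^sub>F s in at t. s \<noteq> t" by (auto simp: eventually_at_filter)
  ultimately show ?thesis by eventually_elim auto
qed

lemma has_derivative_torus_int_mult:
  assumes "continuous_on UNIV \<phi>"
  shows "((\<lambda>s. torus_int (\<lambda>x. u s x * \<phi> x)) has_real_derivative torus_int (\<lambda>x. g x * \<phi> x)) (at t)"
  unfolding has_field_derivative_iff
proof (rule Lim_transform_eventually)
  show "((\<lambda>s. torus_int (\<lambda>x. (u s x - u t x) / (s - t) * \<phi> x)) \<longlongrightarrow> torus_int (\<lambda>x. g x * \<phi> x)) (at t)"
  proof (rule tendsto_torus_int)
    show "\<forall>\<^sub>F s in at t. continuous_on UNIV (\<lambda>x. (u s x - u t x) / (s - t) * \<phi> x)"
      using eventually_pos by eventually_elim (use cu t assms in \<open>auto intro!: continuous_intros\<close>)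
    show "continuous_on UNIV (\<lambda>x. g x * \<phi> x)" by (intro continuous_intros cg assms)
    show "uniform_limit {-pi..pi} (\<lambda>s x. (u s x - u t x) / (s - t) * \<phi> x) (\<lambda>x. g x * \<phi> x) (at t)"
      by (rule uniform_lim_mult[OF U uniform_limit_const]) (intro bounded_torus_image cg assms)+
  qed
  show "\<forall>\<^sub>F s in at t. torus_int (\<lambda>x. (u s x - u t x) / (s - t) * \<phi> x) =
     (torus_int (\<lambda>x. u s x * \<phi> x) - torus_int (\<lambda>x. u t x * \<phi> x)) / (s - t)"
    using eventually_pos
  proof eventually_elim
    case (elim s)
    have "((\<lambda>x. (1 / (s - t)) * (u s x * \<phi> x - u t x * \<phi> x)) has_integral
        (1 / (s - t)) * (torus_int (\<lambda>x. u s x * \<phi> x) - torus_int (\<lambda>x. u t x * \<phi> x))) {-pi..pi}"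
      using elim t by (intro has_integral_mult_right has_integral_diff torus_integrable continuous_intros cu assms) auto
    then show ?case by (intro integral_unique) (simp add: left_diff_distrib diff_divide_distrib)
  qed
qed

text \<open>Writing \<open>a\<^sup>2 - b\<^sup>2 = (a - b) * ((a - b) + 2 * b)\<close> expresses the
  difference quotient of the square through that of \<open>u\<close>, whose uniform convergence is
  given.\<close>

lemma has_derivative_torus_int_square:
  "((\<lambda>s. torus_int (\<lambda>x. (u s x)\<^sup>2)) has_real_derivative 2 * torus_int (\<lambda>x. g x * u t x)) (at t)"
  unfolding has_field_derivative_iff
proof (rule Lim_transform_eventually)
  have ct: "continuous_on UNIV (u t)" by (rule cu[OF t])
  \<comment> \<open>Multiplying the convergent quotient by \<open>s - t\<close> shows that
    \<open>u s\<close> tends to \<open>u t\<close> uniformly.\<close>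
  have "uniform_limit {-pi..pi} (\<lambda>s x. s - t) (\<lambda>x. 0) (at t)"
  proof -
    have "((\<lambda>s. s - t) \<longlongrightarrow> 0) (at t)" by (auto intro!: tendsto_eq_intros)
    then show ?thesis by (auto simp: uniform_limit_iff tendsto_iff elim!: eventually_mono)
  qed
  from uniform_lim_mult[OF this U] have "uniform_limit {-pi..pi} (\<lambda>s x. (s - t) * ((u s x - u t x) / (s - t))) (\<lambda>x. 0 * g x) (at t)"
    by (auto intro!: bounded_torus_image cg simp: image_constant_conv)
  from uniform_limit_add[OF this uniform_limit_const[where c = "\<lambda>x. 2 * u t x"]]
  have "uniform_limit {-pi..pi} (\<lambda>s x. (s - t) * ((u s x - u t x) / (s - t)) + 2 * u t x) (\<lambda>x. 2 * u t x) (at t)"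
    by simp
  then have U2: "uniform_limit {-pi..pi} (\<lambda>s x. (u s x - u t x) / (s - t) * ((s - t) * ((u s x - u t x) / (s - t)) + 2 * u t x))
     (\<lambda>x. g x * (2 * u t x)) (at t)"
    by (rule uniform_lim_mult[OF U]) (intro bounded_torus_image continuous_intros cg ct)+
  have "((\<lambda>s. torus_int (\<lambda>x. (u s x - u t x) / (s - t) * ((s - t) * ((u s x - u t x) / (s - t)) + 2 * u t x)))
      \<longlongrightarrow> torus_int (\<lambda>x. g x * (2 * u t x))) (at t)"
  proof (rule tendsto_torus_int[OF _ _ U2])
    show "\<forall>\<^sub>F s in at t. continuous_on UNIV (\<lambda>x. (u s x - u t x) / (s - t) * ((s - t) * ((u s x - u t x) / (s - t)) + 2 * u t x))"
      using eventually_pos by eventually_elim (use cu ct in \<open>auto intro!: continuous_intros\<close>)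
    show "continuous_on UNIV (\<lambda>x. g x * (2 * u t x))" by (intro continuous_intros cg ct)
  qed
  moreover have "torus_int (\<lambda>x. g x * (2 * u t x)) = 2 * torus_int (\<lambda>x. g x * u t x)"
  proof -
    have "(\<lambda>x. g x * (2 * u t x)) = (\<lambda>x. 2 * (g x * u t x))" by auto
    then show ?thesis by (simp only: integral_mult_right)
  qed
  ultimately show "((\<lambda>s. torus_int (\<lambda>x. (u s x - u t x) / (s - t) * ((s - t) * ((u s x - u t x) / (s - t)) + 2 * u t x)))
      \<longlongrightarrow> 2 * torus_int (\<lambda>x. g x * u t x)) (at t)" by simp
  show "\<forall>\<^sub>F s in at t. torus_int (\<lambda>x. (u s x - u t x) / (s - t) * ((s - t) * ((u s x - u t x) / (s - t)) + 2 * u t x)) =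
     (torus_int (\<lambda>x. (u s x)\<^sup>2) - torus_int (\<lambda>x. (u t x)\<^sup>2)) / (s - t)"
    using eventually_pos
  proof eventually_elim
    case (elim s)
    have "((\<lambda>x. (1 / (s - t)) * ((u s x)\<^sup>2 - (u t x)\<^sup>2)) has_integral
        (1 / (s - t)) * (torus_int (\<lambda>x. (u s x)\<^sup>2) - torus_int (\<lambda>x. (u t x)\<^sup>2))) {-pi..pi}"
      using elim t by (intro has_integral_mult_right has_integral_diff torus_integrable continuous_intros cu) auto
    moreover have "(1 / (s - t)) * ((u s x)\<^sup>2 - (u t x)\<^sup>2)
       = (u s x - u t x) / (s - t) * ((s - t) * ((u s x - u t x) / (s - t)) + 2 * u t x)" for x
    proof -
      have "(s - t) * ((u s x - u t x) / (s - t)) = u s x - u t x" using elim by simp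
      moreover have "(u s x)\<^sup>2 - (u t x)\<^sup>2 = (u s x - u t x) * (u s x - u t x + 2 * u t x)"
        by (simp add: power2_eq_square algebra_simps)
      ultimately show ?thesis by simp
    qed
    ultimately have "((\<lambda>x. (u s x - u t x) / (s - t) * ((s - t) * ((u s x - u t x) / (s - t)) + 2 * u t x)) has_integral
        (1 / (s - t)) * (torus_int (\<lambda>x. (u s x)\<^sup>2) - torus_int (\<lambda>x. (u t x)\<^sup>2))) {-pi..pi}"
      by (simp only:)
    from integral_unique[OF this] show ?case by (simp only: times_divide_eq_left mult_1)
  qed
qed

end

subsection \<open>The initial perturbation\<close>

text \<open>Each derivative shifts the phase by \<open>pi/2\<close>, so one formula serves all
  orders and the norm estimates reduce to shifted cosines.\<close>

lemma deriv_funpow_cos: "(deriv ^^ j) (\<lambda>x. c * cos x) = (\<lambda>x. c * cos (x + of_nat j * (pi/2)))" for c :: real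
proof (induction j)
  case (Suc j)
  have "((\<lambda>x. c * cos (x + of_nat j * (pi/2))) has_real_derivative c * cos (x + of_nat (Suc j) * (pi/2))) (at x)" for x
  proof -
    have "x + of_nat (Suc j) * (pi/2) = (x + of_nat j * (pi/2)) + pi/2" by (simp add: algebra_simps add_divide_distrib)
    then have "cos (x + of_nat (Suc j) * (pi/2)) = - sin (x + of_nat j * (pi/2))" by (simp only: cos_add) simp
    then show ?thesis by (auto intro!: derivative_eq_intros)
  qed
  then show ?case using Suc by (auto intro!: ext DERIV_imp_deriv)
qed simp

text \<open>\<open>deriv\<close> picks a derivative by choice, so both sides agree as soon as the
  same numbers qualify; this covers points where \<open>f\<close> is not differentiable.\<close>

lemma deriv_const_add: "deriv (\<lambda>x. c + f x) = deriv f" for f :: "real \<Rightarrow> real"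
proof
  fix x
  have "((\<lambda>x. c + f x) has_real_derivative D) (at x) \<longleftrightarrow> (f has_real_derivative D) (at x)" for D
  proof
    assume "((\<lambda>x. c + f x) has_real_derivative D) (at x)"
    from DERIV_add[OF this DERIV_const[of "-c"]] show "(f has_real_derivative D) (at x)" by simp
  qed (auto intro!: derivative_eq_intros)
  then show "deriv (\<lambda>x. c + f x) x = deriv f x" by (simp add: deriv_def)
qed

lemma bdd_holder_cos: "0 \<le> a \<Longrightarrow> a \<le> 1 \<Longrightarrow> bdd_holder a (\<lambda>x. c * cos (x + p))"
  by (rule bdd_holder_C1[of _ "\<lambda>x. - (c * sin (x + p))" "\<bar>c\<bar>" "\<bar>c\<bar>"])
     (auto intro!: derivative_eq_intros simp: abs_mult mult_left_le)

lemma little_holder_cos: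
  assumes "0 < \<sigma>"
  shows "little_holder \<sigma> (\<lambda>x. c + d * cos x)"
proof -
  let ?f = "\<lambda>x. c + d * cos x"
  have D: "(deriv ^^ Suc j) ?f = (\<lambda>x. d * cos (x + of_nat (Suc j) * (pi/2)))" for j
    by (simp only: funpow_Suc_right o_apply deriv_const_add) (simp only: deriv_funpow_cos[symmetric] funpow_Suc_right o_apply)
  have diff: "(deriv ^^ j) ?f differentiable at x" for j x
  proof (cases j)
    case 0
    then show ?thesis unfolding real_differentiable_def
      by (intro exI[of _ "- (d * sin x)"]) (auto intro!: derivative_eq_intros)
  next
    case (Suc i)
    then show ?thesis unfolding Suc D real_differentiable_def
      by (intro exI[of _ "- (d * sin (x + of_nat (Suc i) * (pi/2)))"]) (auto intro!: derivative_eq_intros)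
  qed
  have bh: "bdd_holder a ((deriv ^^ j) ?f)" if "0 \<le> a" "a \<le> 1" for a j
  proof (cases j)
    case 0
    then show ?thesis using bdd_holder_add[OF bdd_holder_const bdd_holder_cos[OF that, of d 0]] by simp
  next
    case (Suc k)
    then show ?thesis unfolding Suc D by (intro bdd_holder_cos that)
  qed
  have cont: "continuous_on UNIV ((deriv ^^ j) ?f)" for j
    using diff by (auto intro!: continuous_at_imp_continuous_on differentiable_imp_continuous_within)
  have per: "periodic2pi ?f" by (simp add: periodic2pi_def)
  have "C_holder \<sigma> ?f" unfolding C_holder_def Ck_per_def
  proof (intro conjI allI impI per cont diff)
    show "bdd_above (holder_quot (\<sigma> - of_int \<lfloor>\<sigma>\<rfloor>) ((deriv ^^ nat \<lfloor>\<sigma>\<rfloor>) ?f))"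
      by (intro bdd_holder_quot bh) linarith+
  qed
  moreover have "smooth_per ?f" unfolding smooth_per_def using per diff by blast
  \<comment> \<open>The function is smooth and approximates itself, which leaves the norm of
    zero.\<close>
  moreover have "hnorm \<sigma> (\<lambda>x. ?f x - ?f x) = 0"
  proof -
    have z: "(deriv ^^ j) (\<lambda>x. 0) = (\<lambda>x. 0 :: real)" for j
      by (induction j) (simp_all add: deriv_const[abs_def])
    have "holder_quot b (\<lambda>x. 0) = {0}" for b
      by (auto simp: holder_quot_def)
    then show ?thesis by (simp add: hnorm_def z sup_norm_def holder_seminorm_def)
  qed
  ultimately show ?thesis unfolding little_holder_def by metis
qed

lemma sup_norm_least: "(\<And>x. \<bar>f x\<bar> \<le> B) \<Longrightarrow> sup_norm f \<le> B"
  unfolding sup_norm_def by (intro cSUP_least) auto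

lemma holder_seminorm_least:
  assumes "\<And>x y. \<bar>f x - f y\<bar> \<le> C * \<bar>x - y\<bar> powr a"
  shows "holder_seminorm a f \<le> C"
  unfolding holder_seminorm_def
proof (rule cSup_least)
  have "\<bar>f 0 - f 1\<bar> / \<bar>0 - 1\<bar> powr a \<in> holder_quot a f" unfolding holder_quot_def
    by (intro CollectI exI[of _ 0] exI[of _ 1]) simp
  then show "holder_quot a f \<noteq> {}" by blast
  show "z \<le> C" if "z \<in> holder_quot a f" for z
    using that assms unfolding holder_quot_def by (auto simp: divide_le_eq)
qed

text \<open>A bound linear in \<open>d\<close> allows the perturbation to be put below any given
  \<open>\<delta>\<close>. Every derivative contributes at most the modulus of \<open>d\<close>, the
  top seminorm a fixed multiple of it.\<close>

lemma hnorm_cos_le: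
  assumes "0 < \<sigma>"
  obtains C where "\<And>d. hnorm \<sigma> (\<lambda>x. d * cos x) \<le> C * \<bar>d\<bar>"
proof -
  define k where "k = nat \<lfloor>\<sigma>\<rfloor>"
  define b where "b = \<sigma> - of_int \<lfloor>\<sigma>\<rfloor>"
  have b: "0 \<le> b" "b \<le> 1" unfolding b_def by linarith+
  have "bdd_holder b (\<lambda>x. 1 * cos (x + of_nat k * (pi/2)))" by (rule bdd_holder_cos[OF b])
  then obtain C where C: "\<And>x y. \<bar>cos (x + of_nat k * (pi/2)) - cos (y + of_nat k * (pi/2))\<bar> \<le> C * \<bar>x - y\<bar> powr b"
    by (rule bdd_holderE) (simp, blast)
  show ?thesis
  proof (rule that)
    fix d :: real
    have "sup_norm (\<lambda>x. d * cos (x + of_nat j * (pi/2))) \<le> \<bar>d\<bar>" for j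
      by (rule sup_norm_least) (simp add: abs_mult mult_left_le)
    then have "(\<Sum>j\<le>k. sup_norm (\<lambda>x. d * cos (x + of_nat j * (pi/2)))) \<le> (\<Sum>j\<le>k. \<bar>d\<bar>)" by (intro sum_mono)
    moreover have "holder_seminorm b (\<lambda>x. d * cos (x + of_nat k * (pi/2))) \<le> \<bar>d\<bar> * C"
    proof (rule holder_seminorm_least)
      fix x y
      have "\<bar>d * cos (x + of_nat k * (pi/2)) - d * cos (y + of_nat k * (pi/2))\<bar>
        = \<bar>d\<bar> * \<bar>cos (x + of_nat k * (pi/2)) - cos (y + of_nat k * (pi/2))\<bar>"
        by (simp only: right_diff_distrib[symmetric] abs_mult)
      also have "\<dots> \<le> \<bar>d\<bar> * (C * \<bar>x - y\<bar> powr b)" by (intro mult_left_mono C) simp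
      finally show "\<bar>d * cos (x + of_nat k * (pi/2)) - d * cos (y + of_nat k * (pi/2))\<bar> \<le> \<bar>d\<bar> * C * \<bar>x - y\<bar> powr b"
        by (simp add: mult.assoc)
    qed
    ultimately show "hnorm \<sigma> (\<lambda>x. d * cos x) \<le> (of_nat (Suc k) + C) * \<bar>d\<bar>"
      unfolding hnorm_def deriv_funpow_cos k_def[symmetric] b_def[symmetric] by (simp add: algebra_simps)
  qed
qed

subsection \<open>Exponential growth\<close>

text \<open>This is \<open>growth_form\<close> written out for an arbitrary function. It refers to
  no derivative of \<open>v\<close>, so it can be followed in time, and taken to the limit at time
  \<open>0\<close>, under uniform convergence alone.\<close>

definition unstable_excess :: "(real \<Rightarrow> real) \<Rightarrow> real" where
  "unstable_excess v = 2 / pi * ((torus_int (\<lambda>x. v x * cos x))\<^sup>2 + (torus_int (\<lambda>x. v x * sin x))\<^sup>2)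
     - torus_int (\<lambda>x. (v x)\<^sup>2)"

context c2_torus_function
begin

lemma unstable_excess_eq: "unstable_excess v = growth_form"
  by (simp add: unstable_excess_def growth_form_def first_mode_def cos_mode_def sin_mode_def l2_def
      power_divide power2_eq_square distrib_left)

text \<open>Twice this integral is the derivative of the quadratic form \<open>growth_form\<close>
  in the direction \<open>g\<close>; the right-hand side is what the chain rule produces.\<close>

lemma integral_mult_q:
  assumes "continuous_on UNIV g"
  shows "torus_int (\<lambda>x. g x * q x) = 2 * (cos_mode * torus_int (\<lambda>x. g x * cos x)
    + sin_mode * torus_int (\<lambda>x. g x * sin x)) - torus_int (\<lambda>x. g x * v x)"
proof -
  have "((\<lambda>x. 2 * (cos_mode * (g x * cos x) + sin_mode * (g x * sin x)) - g x * v x) has_integral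
    2 * (cos_mode * torus_int (\<lambda>x. g x * cos x) + sin_mode * torus_int (\<lambda>x. g x * sin x)) - torus_int (\<lambda>x. g x * v x)) {-pi..pi}"
    by (intro has_integral_diff has_integral_add has_integral_mult_right torus_integrable continuous_intros assms cont_v)
  then show ?thesis unfolding q_def by (intro integral_unique) (simp add: algebra_simps)
qed

end

text \<open>Bessel gives \<open>first_mode \<le> l2\<close>, so the form is at most
  \<open>l2\<close>. This is the ceiling that exponential growth will break.\<close>

lemma (in near_cylinder) growth_form_le: "growth_form \<le> 2 * pi"
proof -
  have "(v x)\<^sup>2 \<le> 1" for x using small(1)[of x] e by (simp add: abs_square_le_1)
  then have "l2 \<le> 2 * pi" by (intro has_integral_le[OF basic_integrals(4) torus_trig_integrals(1)])
  moreover have "0 \<le> mass\<^sup>2 / (2*pi)" by simp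
  ultimately show ?thesis unfolding growth_form_def using bessel_first_modes by linarith
qed

lemma tendsto_unstable_excess:
  assumes f: "\<forall>\<^sub>F s in F. continuous_on UNIV (f s)" and l: "continuous_on UNIV l"
    and u: "uniform_limit {-pi..pi} f l F"
  shows "((\<lambda>s. unstable_excess (f s)) \<longlongrightarrow> unstable_excess l) F"
proof -
  have m: "((\<lambda>s. torus_int (\<lambda>x. f s x * \<phi> x)) \<longlongrightarrow> torus_int (\<lambda>x. l x * \<phi> x)) F" if "continuous_on UNIV \<phi>" for \<phi>
  proof (rule tendsto_torus_int)
    show "\<forall>\<^sub>F s in F. continuous_on UNIV (\<lambda>x. f s x * \<phi> x)"
      using f by eventually_elim (intro continuous_intros that)
    show "continuous_on UNIV (\<lambda>x. l x * \<phi> x)" by (intro continuous_intros l that)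
    show "uniform_limit {-pi..pi} (\<lambda>s x. f s x * \<phi> x) (\<lambda>x. l x * \<phi> x) F"
      by (rule uniform_lim_mult[OF u uniform_limit_const]) (intro bounded_torus_image l that)+
  qed
  have "((\<lambda>s. torus_int (\<lambda>x. (f s x)\<^sup>2)) \<longlongrightarrow> torus_int (\<lambda>x. (l x)\<^sup>2)) F"
    unfolding power2_eq_square
  proof (rule tendsto_torus_int)
    show "\<forall>\<^sub>F s in F. continuous_on UNIV (\<lambda>x. f s x * f s x)"
      using f by eventually_elim (intro continuous_intros)
    show "continuous_on UNIV (\<lambda>x. l x * l x)" by (intro continuous_intros l)
    show "uniform_limit {-pi..pi} (\<lambda>s x. f s x * f s x) (\<lambda>x. l x * l x) F"
      by (rule uniform_lim_mult[OF u u]) (intro bounded_torus_image l)+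
  qed
  then show ?thesis unfolding unstable_excess_def
    by (intro tendsto_intros m continuous_intros)
qed

lemma unstable_excess_cos: "unstable_excess (\<lambda>x. d * cos x) = pi * d\<^sup>2"
proof -
  have "unstable_excess (\<lambda>x. d * cos x) = 2 / pi * ((d * pi)\<^sup>2 + (d * 0)\<^sup>2) - d\<^sup>2 * pi"
    using torus_trig_integrals(4,6)[THEN integral_unique]
    by (simp add: unstable_excess_def power_mult_distrib mult.assoc power2_eq_square[of "cos _"])
  then show ?thesis by (simp add: power2_eq_square)
qed

text \<open>At \<open>e = 0\<close> the main condition reads
  \<open>(\<beta> + k) * rs\<^sup>2 \<le> 1\<close>; strict inequality there persists for small
  \<open>e\<close>. The assumption \<open>rs < 1\<close> enters here:
  \<open>1 / rs\<^sup>2 > 1\<close> leaves room for \<open>\<beta>\<close> above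
  \<open>1\<close>.\<close>

lemma small_radius_exists:
  fixes rs :: real
  assumes rs: "0 < rs" "rs < 1"
  obtains \<beta> k e :: real where "1 < \<beta>" "\<beta> < 2" "\<beta> < 1 / rs\<^sup>2" "0 < k" "k \<le> (\<beta> - 1)/2" "k \<le> (2 - \<beta>)/4"
    "0 < e" "e \<le> 1" "e \<le> rs/2" "(\<beta> + k) * (rs * ((rs + e) * (1 + e))) \<le> 1" "e * (1 + 2 / rs ^ 3 + 4 / rs) \<le> k"
proof -
  define L where "L = 1 / rs\<^sup>2"
  have "rs\<^sup>2 < 1" using rs by (simp add: power_less_one_iff)
  then have L: "1 < L" using rs by (simp add: L_def)
  define \<beta> where "\<beta> = (1 + min 2 L)/2"
  have b: "1 < \<beta>" "\<beta> < 2" "\<beta> < L" using L by (auto simp: \<beta>_def min_def)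
  \<comment> \<open>The first entry keeps \<open>\<beta> + k\<close> strictly below
    \<open>L\<close>; the other two are the margins demanded by
    \<open>growth_form_coercive\<close>.\<close>
  define k where "k = min ((L - \<beta>)/2) (min ((\<beta> - 1)/2) ((2 - \<beta>)/4))"
  have k: "0 < k" "k \<le> (\<beta> - 1)/2" "k \<le> (2 - \<beta>)/4" "k \<le> (L - \<beta>)/2" using b by (auto simp: k_def min_def)
  have "2 * k \<le> L - \<beta>" using k(4) by simp
  then have "\<beta> + k < L" using b by linarith
  then have "(\<beta> + k) * (rs * ((rs + 0) * (1 + 0))) < 1" using rs by (simp add: L_def field_simps power2_eq_square)
  moreover have "((\<lambda>e. (\<beta> + k) * (rs * ((rs + e) * (1 + e)))) \<longlongrightarrow> (\<beta> + k) * (rs * ((rs + 0) * (1 + 0)))) (at_right 0)"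
    by (intro tendsto_intros)
  ultimately have "\<forall>\<^sub>F e in at_right 0. (\<beta> + k) * (rs * ((rs + e) * (1 + e))) < 1"
    using order_tendstoD(2) by blast
  moreover have "((\<lambda>e. e * (1 + 2 / rs ^ 3 + 4 / rs)) \<longlongrightarrow> 0 * (1 + 2 / rs ^ 3 + 4 / rs)) (at_right 0)"
    by (intro tendsto_intros)
  then have "\<forall>\<^sub>F e in at_right 0. e * (1 + 2 / rs ^ 3 + 4 / rs) < k"
    using order_tendstoD(2) k(1) by force
  moreover have "\<forall>\<^sub>F e in at_right (0::real). e \<in> {0<..<min 1 (rs/2)}"
    by (rule eventually_at_right_real) (use rs in simp)
  ultimately have "\<forall>\<^sub>F e in at_right 0. (\<beta> + k) * (rs * ((rs + e) * (1 + e))) < 1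
     \<and> e * (1 + 2 / rs ^ 3 + 4 / rs) < k \<and> e \<in> {0<..<min 1 (rs/2)}"
    by eventually_elim auto
  from eventually_happens'[OF _ this] obtain e where
    "(\<beta> + k) * (rs * ((rs + e) * (1 + e))) < 1" "e * (1 + 2 / rs ^ 3 + 4 / rs) < k" "e \<in> {0<..<min 1 (rs/2)}"
    by auto
  then show ?thesis using b k L_def by (intro that[of \<beta> k e]) auto
qed

section \<open>Instability: exponential growth against boundedness\<close>

theorem theorem5p4:
  fixes \<alpha> \<mu> rs :: real
  assumes "0 < \<alpha>" and "\<alpha> < 1"
    and "0 < rs" and "rs < 1"
    and "1/2 \<le> \<mu>" and "\<mu> \<le> 1"
    and "2*\<mu> + \<alpha> \<notin> \<int>"
  shows "\<not> stable_eq \<alpha> \<mu> rs"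
proof
  assume st: "stable_eq \<alpha> \<mu> rs"
  note \<alpha> = assms(1,2)
  obtain \<beta> k e :: real where b: "1 < \<beta>" "\<beta> < 2" "\<beta> < 1 / rs\<^sup>2" and k: "0 < k" "k \<le> (\<beta> - 1)/2" "k \<le> (2 - \<beta>)/4"
    and e: "0 < e" "e \<le> 1" "e \<le> rs/2" and S: "(\<beta> + k) * (rs * ((rs + e) * (1 + e))) \<le> 1"
    and K: "e * (1 + 2 / rs ^ 3 + 4 / rs) \<le> k"
    using small_radius_exists[OF assms(3,4)] by metis
  define \<sigma> where "\<sigma> = 2*\<mu> + \<alpha>"
  have \<sigma>: "1 \<le> \<sigma>" "\<sigma> \<le> 2 + \<alpha>" using assms by (simp_all add: \<sigma>_def)
  from st e(1) obtain \<delta> where \<delta>: "0 < \<delta>" and stab: "\<And>r0. little_holder \<sigma> r0 \<Longrightarrow> hnorm \<sigma> (\<lambda>x. r0 x - rs) < \<delta> \<Longrightarrow>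
         (\<exists>r. global_sol \<alpha> \<mu> r0 r \<and> (\<forall>t\<ge>0. hnorm \<sigma> (\<lambda>x. r t x - rs) < e))"
    unfolding stable_eq_def \<sigma>_def by blast
  obtain C where C: "\<And>d. hnorm \<sigma> (\<lambda>x. d * cos x) \<le> C * \<bar>d\<bar>" using hnorm_cos_le[of \<sigma>] \<sigma> by auto
  \<comment> \<open>The absolute value and the \<open>+ 1\<close> make the denominator positive
    whatever the sign of \<open>C\<close>; the factor \<open>2\<close> makes the bound
    strict.\<close>
  define d where "d = \<delta> / (2 * (\<bar>C\<bar> + 1))"
  have d: "0 < d" using \<delta> by (simp add: d_def add_nonneg_pos)
  have "C * \<bar>d\<bar> \<le> (\<bar>C\<bar> + 1) * d" using d by (simp add: mult_right_mono)
  also have "\<dots> = \<delta> / 2" by (simp add: d_def field_simps)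
  also have "\<dots> < \<delta>" using \<delta> by simp
  finally have near: "hnorm \<sigma> (\<lambda>x. (rs + d * cos x) - rs) < \<delta>" using C[of d] by simp
  have "0 < \<sigma>" using \<sigma> by simp
  from stab[OF little_holder_cos[OF this] near] obtain r where sol: "global_sol \<alpha> \<mu> (\<lambda>x. rs + d * cos x) r"
    and close: "\<And>t. 0 \<le> t \<Longrightarrow> hnorm \<sigma> (\<lambda>x. r t x - rs) < e"
    by blast
  define \<eta> where "\<eta> = 1 / rs\<^sup>2 - \<beta>"
  have \<eta>: "0 < \<eta>" using b by (simp add: \<eta>_def)
  \<comment> \<open>For \<open>\<mu> < 1\<close> the regularity classes speak only of
    \<open>t > 0\<close>, so all estimates are made at positive times and time \<open>0\<close> is
    reached as a limit.\<close>
  have tdom: "t \<in> tdom \<mu>" if "0 < t" for t using that by (simp add: tdom_def)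
  have ha: "C_holder \<alpha> (r t)" and h2: "C_holder (2 + \<alpha>) (r t)" if "0 < t" for t
    using sol tdom[OF that] by (auto simp: global_sol_def wC1_def wcont_def little_holder_def)
  have bh: "bdd_holder \<alpha> (r t)" and cont: "continuous_on UNIV (r t)" if "0 < t" for t
    using C_holder_unitD[OF ha[OF that] \<alpha>] by auto
  define v where "v t x = r t x - rs" for t x
  have cv: "continuous_on UNIV (v t)" if "0 < t" for t
    unfolding v_def by (intro continuous_intros cont that)
  define \<Phi> where "\<Phi> t = unstable_excess (v t)" for t

  have ineq: "\<exists>D. (\<Phi> has_real_derivative D) (at t) \<and> 2 * \<eta> * \<Phi> t \<le> D \<and> \<Phi> t \<le> 2 * pi" if t: "0 < t" for t
  proof -
    note D = C_holder_2D[OF h2[OF t] \<alpha>]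
    have close': "\<bar>r t x - rs\<bar> \<le> e" "\<bar>deriv (r t) x\<bar> \<le> e" for x
      using hnorm_controls_C1[OF h2[OF t] \<alpha> \<sigma>, of x rs] close[of t] t by linarith+
    interpret near_cylinder "v t" "deriv (r t)" "deriv (deriv (r t))" rs e
    proof
      show "(v t has_real_derivative deriv (r t) x) (at x)" for x
        unfolding v_def by (auto intro!: derivative_eq_intros D)
      show "v t (-pi) = v t pi" using periodic2pi_endpoints[OF D(1)] by (simp add: v_def)
    qed (use D periodic2pi_endpoints[OF D(2)] assms e close' in \<open>auto simp: v_def\<close>)
    have req: "(\<lambda>x. rs + v t x) = r t" by (simp add: v_def)
    let ?G = "G_op (r t)"
    have cG: "continuous_on UNIV ?G" using cont_G unfolding req .
    have hG: "bdd_holder \<alpha> ?G" using bdd_holder_G[OF D(6)] \<alpha> unfolding req by simp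
    \<comment> \<open>The equation holds in \<open>hnorm \<alpha>\<close>, while differentiating the
      integrals takes uniform convergence; \<open>hnorm_unit_upper\<close> provides it once the
      difference is known to be a bounded Hoelder function.\<close>
    have U: "uniform_limit {-pi..pi} (\<lambda>s x. (v s x - v t x) / (s - t)) ?G (at t)"
      unfolding uniform_limit_iff
    proof (intro allI impI)
      fix \<epsilon> :: real assume \<epsilon>: "0 < \<epsilon>"
      have "at t within {0<..} = at t" using t by (intro at_within_open) auto
      then have "((\<lambda>s. hnorm \<alpha> (\<lambda>x. (r s x - r t x) / (s - t) - ?G x)) \<longlongrightarrow> 0) (at t)"
        using sol t by (auto simp: global_sol_def has_hderiv_def)
      from order_tendstoD(2)[OF this \<epsilon>]
      have 1: "\<forall>\<^sub>F s in at t. hnorm \<alpha> (\<lambda>x. (r s x - r t x) / (s - t) - ?G x) < \<epsilon>" .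
      have 2: "\<forall>\<^sub>F s in at t. s \<in> {0<..}" by (rule eventually_at_in_open') (use t in auto)
      from 1 2 show "\<forall>\<^sub>F s in at t. \<forall>x\<in>{-pi..pi}. dist ((v s x - v t x) / (s - t)) (?G x) < \<epsilon>"
      proof eventually_elim
        case (elim s)
        have "bdd_holder \<alpha> (\<lambda>x. (1 / (s - t)) * (r s x - r t x) - ?G x)"
          using elim t by (intro bdd_holder_diff bdd_holder_cmult bh hG) auto
        then have "bdd_holder \<alpha> (\<lambda>x. (r s x - r t x) / (s - t) - ?G x)" by simp
        then have "\<bar>(r s x - r t x) / (s - t) - ?G x\<bar> < \<epsilon>" for x
          by (rule le_less_trans[OF hnorm_unit_upper[OF _ \<alpha>] elim(1)])
        then show ?case by (simp add: dist_real_def v_def)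
      qed
    qed
    note der = has_derivative_torus_int_mult[OF t cv cG U] has_derivative_torus_int_square[OF t cv cG U]
    let ?D = "2 / pi * (2 * torus_int (\<lambda>x. v t x * cos x) * torus_int (\<lambda>x. ?G x * cos x)
       + 2 * torus_int (\<lambda>x. v t x * sin x) * torus_int (\<lambda>x. ?G x * sin x)) - 2 * torus_int (\<lambda>x. ?G x * v t x)"
    have "(\<Phi> has_real_derivative ?D) (at t)"
      unfolding \<Phi>_def unstable_excess_def
      by (rule derivative_eq_intros der continuous_intros refl | simp)+
    moreover have "?D = 2 * torus_int (\<lambda>x. ?G x * q x)"
      unfolding integral_mult_q[OF cG] by (simp add: cos_mode_def sin_mode_def algebra_simps)
    moreover have "\<eta> * \<Phi> t \<le> torus_int (\<lambda>x. ?G x * q x)"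
      using growth_form_coercive[OF b(1,2) k S K] unfolding req \<eta>_def \<Phi>_def unstable_excess_eq by simp
    moreover have "\<Phi> t \<le> 2 * pi" unfolding \<Phi>_def unstable_excess_eq by (rule growth_form_le)
    ultimately show ?thesis by auto
  qed

  \<comment> \<open>An integrating factor: by the differential inequality this product is
    nondecreasing.\<close>
  define \<Psi> where "\<Psi> t = exp (- (2 * \<eta> * t)) * \<Phi> t" for t
  have mono: "\<Psi> s \<le> \<Psi> t" if "0 < s" "s \<le> t" for s t
  proof (rule DERIV_nonneg_imp_nondecreasing[OF that(2)])
    fix x assume "s \<le> x" "x \<le> t"
    with that obtain D where D: "(\<Phi> has_real_derivative D) (at x)" "2 * \<eta> * \<Phi> x \<le> D" using ineq[of x] by auto
    have "(\<Psi> has_real_derivative exp (- (2 * \<eta> * x)) * (D - 2 * \<eta> * \<Phi> x)) (at x)"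
      unfolding \<Psi>_def by (auto intro!: derivative_eq_intros D simp: algebra_simps)
    then show "\<exists>y. (\<Psi> has_real_derivative y) (at x) \<and> 0 \<le> y" using D by (intro exI conjI) auto
  qed

  have "uniform_limit {-pi..pi} v (\<lambda>x. d * cos x) (at_right 0)"
    unfolding uniform_limit_iff
  proof (intro allI impI)
    fix \<epsilon> :: real assume \<epsilon>: "0 < \<epsilon>"
    have "((\<lambda>t. hnorm \<alpha> (\<lambda>x. r t x - (rs + d * cos x))) \<longlongrightarrow> 0) (at_right 0)"
      using sol by (auto simp: global_sol_def)
    from order_tendstoD(2)[OF this \<epsilon>] eventually_at_right_less[of "0::real"]
    show "\<forall>\<^sub>F s in at_right 0. \<forall>x\<in>{-pi..pi}. dist (v s x) (d * cos x) < \<epsilon>"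
    proof eventually_elim
      case (elim s)
      have "bdd_holder \<alpha> (\<lambda>x. r s x - (rs + d * cos (x + 0)))"
        using elim \<alpha> by (intro bdd_holder_diff bdd_holder_add bdd_holder_const bdd_holder_cos bh) auto
      then have "bdd_holder \<alpha> (\<lambda>x. r s x - (rs + d * cos x))" by simp
      then have "\<bar>r s x - (rs + d * cos x)\<bar> < \<epsilon>" for x
        by (rule le_less_trans[OF hnorm_unit_upper[OF _ \<alpha>] elim(1)])
      then show ?case by (simp add: dist_real_def v_def diff_diff_eq)
    qed
  qed
  then have "(\<Phi> \<longlongrightarrow> pi * d\<^sup>2) (at_right 0)"
    unfolding \<Phi>_def unstable_excess_cos[symmetric]
    by (intro tendsto_unstable_excess continuous_intros)
       (auto intro: eventually_mono[OF eventually_at_right_less[of "0::real"]] cv)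
  then have "(\<Psi> \<longlongrightarrow> exp (- (2 * \<eta> * 0)) * (pi * d\<^sup>2)) (at_right 0)"
    unfolding \<Psi>_def by (intro tendsto_intros)
  then have lim: "(\<Psi> \<longlongrightarrow> pi * d\<^sup>2) (at_right 0)" by simp
  have low: "pi * d\<^sup>2 \<le> \<Psi> t" if "0 < t" for t
  proof (rule tendsto_upperbound[OF lim])
    show "\<forall>\<^sub>F s in at_right 0. \<Psi> s \<le> \<Psi> t"
      using eventually_at_right_real[OF that] by eventually_elim (auto intro: mono)
  qed simp
  \<comment> \<open>Chosen so that \<open>2 * \<eta> * t * d\<^sup>2 = 2\<close>; then
    \<open>1 + x \<le> exp x\<close> already lifts the lower bound past the ceiling.\<close>
  define t where "t = 1 / (\<eta> * d\<^sup>2)"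
  have t: "0 < t" using \<eta> d by (simp add: t_def)
  have "exp (2 * \<eta> * t) * (pi * d\<^sup>2) \<le> exp (2 * \<eta> * t) * \<Psi> t" by (intro mult_left_mono low t) simp
  also have "\<dots> = \<Phi> t" by (simp add: \<Psi>_def mult.assoc[symmetric] exp_add[symmetric])
  also have "\<dots> \<le> 2 * pi" using ineq[OF t] by blast
  finally have "exp (2 * \<eta> * t) * d\<^sup>2 \<le> 2" by simp
  moreover have "(1 + 2 * \<eta> * t) * d\<^sup>2 \<le> exp (2 * \<eta> * t) * d\<^sup>2" by (intro mult_right_mono exp_ge_add_one_self) simp
  moreover have "(1 + 2 * \<eta> * t) * d\<^sup>2 = d\<^sup>2 + 2" using \<eta> d by (simp add: t_def field_simps)
  moreover have "0 < d\<^sup>2" using d by simp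
  ultimately show False by linarith
qed

end
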